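(* Let $G$ be a finite perfect POEC group and let $p$ be a prime dividing $|G|$. Suppose that at least one of the following conditions holds: (i) at least one of the numbers $2^4$, $3$, $5$ does not divide $|G|$; (ii) $p\not\equiv \pm 1 \pmod{10}$. Then $p^3$ divides $|G|$.
   Context: A group $G$ is said to have the POEC property (is a POEC group) if any two elements of prime order in $G$ commute with each other (the primes may be equal or different). A group $G$ is perfect if $G=G'$, where $G'$ is its commutator subgroup. *)

theory Defs
  imports "HOL-Algebra.Algebra" "HOL-Number_Theory.Cong"
begin

definition POEC_group :: "('a, 'b) monoid_scheme \<Rightarrow> bool" where
  "POEC_group G \<longleftrightarrow> group G \<and>
     (\<forall>x \<in> carrier G. \<forall>y \<in> carrier G.
        Factorial_Ring.prime (group.ord G x) \<longrightarrow> Factorial_Ring.prime (group.ord G y) \<longrightarrow> x \<otimes>\<^bsub>G\<^esub> y = y \<otimes>\<^bsub>G\<^esub> x)"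

definition perfect_group :: "('a, 'b) monoid_scheme \<Rightarrow> bool" where
  "perfect_group G \<longleftrightarrow> group G \<and> derived G (carrier G) = carrier G"

end

theory Submission
  imports Defs "HOL-Number_Theory.Quadratic_Reciprocity"
begin

text \<open>
Let V be the set of solutions of \<open>x^p = 1\<close> in \<open>G\<close>. Since elements of prime order commute, V is a
normal elementary abelian p-subgroup. Suppose that \<open>p^3\<close> does not divide the order of \<open>G\<close>.

If V were central, then a Sylow p-subgroup, of order p or \<open>p^2\<close>, would be abelian and contain a
central element z of order p. The transfer of \<open>G\<close> into this abelian subgroup sends z to a power of z with
exponent prime to p; but a perfect group has no nontrivial homomorphism into an abelian group
(\<open>perfect_group_no_central_prime_order\<close>, \<open>perfect_group_prime_cube_dvd_if_central\<close>). If V had order p, the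
action on V would be multiplication of exponents by units modulo p, hence trivial as \<open>G\<close> is perfect.
So V has order \<open>p^2\<close> and is not central, it is a Sylow subgroup, and with C the centralizer of V the
quotient H = G/C is a nontrivial perfect group of order prime to p acting faithfully on V. The determinant
of the action is a homomorphism into an abelian group, so H lies in SL(2, p).

The core is the determination of \<open>|H : Z(H)|\<close>, in the spirit of Dickson. For a non-scalar x in H the
centralizer is abelian, and a conjugate of x that commutes with x is x or its inverse. Hence the
centralizers of noncentral elements partition H outside its centre, and each has index at most 2 in its
normalizer. Counting H along the conjugacy classes of these centralizers gives the class equation that
leads to the rotation groups of the sphere; the cyclic, dihedral, tetrahedral and octahedral solutions are
those with a class of at most three centralizers, which would give a transitive action of a perfect
group on 2 or 3 points or an abelian subgroup of index at most 2. Only \<open>|H : Z(H)| = 60\<close> survives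
(\<open>icosahedral_class_equation\<close>, \<open>perfect_group_abelian_centralizers_order\<close>).

Now p is odd, because it does not divide \<open>|H|\<close>, so the only involution of SL(2, p) is the scalar -1;
thus \<open>Z(H)\<close> has even order and 120 divides \<open>|H|\<close>. An element of order 5 has a trace t with
\<open>t^2 + t = 1\<close> modulo p, so 5 is a square modulo p and quadratic reciprocity yields
\<open>p \<equiv> \<plusminus>1\<close> modulo 10. Finally an involution of \<open>G\<close> commutes with V, so C has even order and 240
divides \<open>|G|\<close>. Both alternatives of the hypothesis are contradicted.
\<close>

section \<open>Perfect groups\<close>

lemma perfect_group_subset_subgroup:
  fixes G (structure)
  assumes "perfect_group G" "subgroup K G"
    and comm: "\<And>g h. g \<in> carrier G \<Longrightarrow> h \<in> carrier G \<Longrightarrow>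
      g \<otimes>\<^bsub>G\<^esub> h \<otimes>\<^bsub>G\<^esub> inv\<^bsub>G\<^esub> g \<otimes>\<^bsub>G\<^esub> inv\<^bsub>G\<^esub> h \<in> K"
  shows "K = carrier G"
proof -
  interpret group G using assms(1) by (simp add: perfect_group_def)
  have "derived G (carrier G) \<subseteq> K"
    unfolding derived_def by (rule generate_subgroup_incl[OF _ assms(2)]) (auto intro: comm)
  with assms(1) subgroup.subset[OF assms(2)] show ?thesis
    by (simp add: perfect_group_def)
qed

lemma perfect_group_hom_commuting_image:
  fixes G (structure) and K
  assumes "perfect_group G" "group K" "f \<in> hom G K"
    and comm: "\<And>g h. g \<in> carrier G \<Longrightarrow> h \<in> carrier G \<Longrightarrow> f g \<otimes>\<^bsub>K\<^esub> f h = f h \<otimes>\<^bsub>K\<^esub> f g"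
    and "x \<in> carrier G"
  shows "f x = \<one>\<^bsub>K\<^esub>"
proof -
  interpret group_hom G K f
    using assms by (simp add: group_hom_def group_hom_axioms_def perfect_group_def)
  have "kernel G K f = carrier G"
  proof (rule perfect_group_subset_subgroup[OF assms(1) subgroup_kernel])
    fix g h assume gh: "g \<in> carrier G" "h \<in> carrier G"
    have "f g \<otimes>\<^bsub>K\<^esub> f h \<otimes>\<^bsub>K\<^esub> inv\<^bsub>K\<^esub> f g \<otimes>\<^bsub>K\<^esub> inv\<^bsub>K\<^esub> f h
        = f h \<otimes>\<^bsub>K\<^esub> f g \<otimes>\<^bsub>K\<^esub> inv\<^bsub>K\<^esub> f g \<otimes>\<^bsub>K\<^esub> inv\<^bsub>K\<^esub> f h"
      using comm[OF gh] by simp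
    also have "\<dots> = \<one>\<^bsub>K\<^esub>" using gh by (simp add: H.m_assoc)
    finally show "g \<otimes> h \<otimes> inv g \<otimes> inv h \<in> kernel G K f"
      using gh by (simp add: kernel_def)
  qed
  with assms(5) show ?thesis by (auto simp: kernel_def)
qed

text \<open>For modulus \<open>m = 0\<close> the congruence is equality of integers, so this covers the sign of a
permutation as well as determinants modulo a prime.\<close>

lemma perfect_group_mult_mod:
  fixes G (structure) and f :: "'a \<Rightarrow> int"
  assumes "perfect_group G"
    and mult: "\<And>g h. g \<in> carrier G \<Longrightarrow> h \<in> carrier G \<Longrightarrow> [f (g \<otimes>\<^bsub>G\<^esub> h) = f g * f h] (mod m)"
    and one: "[f \<one>\<^bsub>G\<^esub> = 1] (mod m)"
    and "x \<in> carrier G"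
  shows "[f x = 1] (mod m)"
proof -
  interpret group G using assms(1) by (simp add: perfect_group_def)
  have inv: "[f g * f (inv g) = 1] (mod m)" if "g \<in> carrier G" for g
    using cong_trans[OF cong_sym[OF mult[of g "inv g"]]] one that by simp
  have sub: "subgroup {g \<in> carrier G. [f g = 1] (mod m)} G"
  proof (rule subgroupI)
    fix g assume "g \<in> {g \<in> carrier G. [f g = 1] (mod m)}"
    then have g: "g \<in> carrier G" "[f g = 1] (mod m)" by auto
    have "[f g * f (inv g) = 1 * f (inv g)] (mod m)" using g(2) by (rule cong_scalar_right)
    with inv[OF g(1)] have "[f (inv g) = 1] (mod m)" by (simp add: cong_def)
    with g show "inv g \<in> {g \<in> carrier G. [f g = 1] (mod m)}" by simp
  next
    fix g h assume "g \<in> {g \<in> carrier G. [f g = 1] (mod m)}" "h \<in> {g \<in> carrier G. [f g = 1] (mod m)}"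
    then have "g \<in> carrier G" "h \<in> carrier G" "[f g * f h = 1 * 1] (mod m)"
      using cong_mult[of "f g" 1 m "f h" 1] by auto
    then show "g \<otimes> h \<in> {g \<in> carrier G. [f g = 1] (mod m)}"
      using mult[of g h] by (auto intro: cong_trans)
  qed (use one in auto)
  have "{g \<in> carrier G. [f g = 1] (mod m)} = carrier G"
  proof (rule perfect_group_subset_subgroup[OF assms(1) sub])
    fix g h assume gh: "g \<in> carrier G" "h \<in> carrier G"
    have "[f (g \<otimes> h \<otimes> inv g \<otimes> inv h) = f g * f h * f (inv g) * f (inv h)] (mod m)"
      using gh by (intro cong_trans[OF mult] cong_scalar_right) auto
    also have "f g * f h * f (inv g) * f (inv h) = (f g * f (inv g)) * (f h * f (inv h))"
      by (simp add: algebra_simps)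
    also have "[(f g * f (inv g)) * (f h * f (inv h)) = 1 * 1] (mod m)"
      by (intro cong_mult inv gh)
    finally show "g \<otimes> h \<otimes> inv g \<otimes> inv h \<in> {g \<in> carrier G. [f g = 1] (mod m)}"
      using gh by simp
  qed
  with assms(4) show ?thesis by blast
qed

lemma perfect_group_surj_hom:
  assumes "perfect_group G" "group K" "f \<in> hom G K" "f ` carrier G = carrier K"
  shows "perfect_group K"
proof -
  interpret group_hom G K f
    using assms by (simp add: group_hom_def group_hom_axioms_def perfect_group_def)
  show ?thesis
    using derived_img[of "carrier G"] assms by (simp add: perfect_group_def)
qed

lemma group_prime_order_commute:
  fixes G (structure)
  assumes "group G" "Factorial_Ring.prime (order G)" "x \<in> carrier G" "y \<in> carrier G"
  shows "x \<otimes> y = y \<otimes> x"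
proof -
  interpret group G by fact
  have fin: "finite (carrier G)"
    using prime_gt_0_nat[OF assms(2)] by (simp add: order_gt_0_iff_finite)
  show ?thesis
  proof (cases "x = \<one>")
    case True with assms(4) show ?thesis by simp
  next
    case False
    have "ord x dvd order G" using assms(3) by (rule ord_dvd_group_order)
    then have "ord x = 1 \<or> ord x = order G" using assms(2) unfolding prime_nat_iff by blast
    with False have "ord x = order G"
      using ord_eq_1[OF assms(3)] by blast
    then have "card (generate G {x}) = card (carrier G)"
      using generate_pow_card[OF assms(3)] by (simp add: order_def)
    moreover have "generate G {x} \<subseteq> carrier G" using generate_incl[of "{x}"] assms(3) by simp
    ultimately have "generate G {x} = carrier G" using fin by (simp add: card_subset_eq)
    then have "y \<in> {x [^] k | k. k \<in> (UNIV :: int set)}" using generate_pow[OF assms(3)] assms(4) by simp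
    then obtain k :: int where k: "y = x [^] k" by blast
    have "x \<otimes> y = x [^] (1 + k)" unfolding k by (simp add: int_pow_mult assms(3))
    also have "1 + k = k + 1" by simp
    also have "x [^] (k + 1) = y \<otimes> x" unfolding k by (simp add: int_pow_mult assms(3))
    finally show ?thesis .
  qed
qed

text \<open>The quotient would be a nontrivial abelian image, being of prime order.\<close>

lemma perfect_group_no_normal_prime_index:
  fixes G (structure)
  assumes perf: "perfect_group G" and N: "N \<lhd> G" and pr: "Factorial_Ring.prime (card (rcosets N))"
  shows False
proof -
  interpret G: group G using perf by (simp add: perfect_group_def)
  interpret N: normal N G by (rule N)
  have order: "order (G Mod N) = card (rcosets N)" by (simp add: order_def FactGroup_def)
  have triv: "N #> g = N" if "g \<in> carrier G" for g
  proof -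
    have "N #> g = \<one>\<^bsub>G Mod N\<^esub>"
    proof (rule perfect_group_hom_commuting_image[OF perf N.factorgroup_is_group N.r_coset_hom_Mod _ that])
      fix g h assume "g \<in> carrier G" "h \<in> carrier G"
      then show "(N #> g) \<otimes>\<^bsub>G Mod N\<^esub> (N #> h) = (N #> h) \<otimes>\<^bsub>G Mod N\<^esub> (N #> g)"
        using pr order
        by (intro group_prime_order_commute[OF N.factorgroup_is_group]) (auto simp: carrier_FactGroup)
    qed
    then show ?thesis by simp
  qed
  then have "rcosets N \<subseteq> {N}" unfolding RCOSETS_def by blast
  then have "card (rcosets N) \<le> 1" using card_mono[of "{N}" "rcosets N"] by simp
  then show False using prime_gt_1_nat[OF pr] by linarith
qed

section \<open>Transfer into an abelian subgroup\<close>

text \<open>The transfer of \<open>z\<close> into \<open>P\<close> is this power of \<open>z\<close>, and it is trivial because \<open>P\<close> is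
abelian and the group is perfect. The transfer is obtained by comparing transversals: for two choices
t and u of representatives of the cosets of \<open>P\<close>, let \<open>\<delta> t u\<close> be the product over all cosets c
of \<open>t c \<otimes> inv (u c)\<close>. This is multiplicative along t, u, w and unchanged when both transversals are
shifted by the same g, so comparing a transversal with its shift by g depends multiplicatively on g.\<close>

lemma perfect_group_central_pow_index:
  fixes G (structure)
  assumes perf: "perfect_group G" and fin: "finite (carrier G)" and P: "subgroup P G"
    and comm: "\<And>x y. x \<in> P \<Longrightarrow> y \<in> P \<Longrightarrow> x \<otimes> y = y \<otimes> x"
    and zP: "z \<in> P" and central: "\<And>g. g \<in> carrier G \<Longrightarrow> z \<otimes> g = g \<otimes> z"
  shows "z [^] card (rcosets P) = \<one>"
proof -
  interpret group G using perf by (simp add: perfect_group_def)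
  interpret P: subgroup P G by (rule P)
  define K where "K = G\<lparr>carrier := P\<rparr>"
  interpret K: comm_group K
    unfolding K_def by (rule group.group_comm_groupI) (use P comm in \<open>auto intro: subgroup_imp_group\<close>)
  have K_simps [simp]: "carrier K = P" "x \<otimes>\<^bsub>K\<^esub> y = x \<otimes> y" "\<one>\<^bsub>K\<^esub> = \<one>" for x y
    by (simp_all add: K_def)
  let ?C = "rcosets P"
  define T where "T = {t. \<forall>c\<in>?C. t c \<in> c}"
  define \<delta> where "\<delta> t u = finprod K (\<lambda>c. t c \<otimes> inv (u c)) ?C" for t u
  define sh where "sh t g c = t (c #> inv g) \<otimes> g" for t :: "'a set \<Rightarrow> 'a" and g c
  have cosE: "\<exists>x\<in>carrier G. c = P #> x" if "c \<in> ?C" for c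
    using that by (auto simp: RCOSETS_def)
  have carr: "t c \<in> carrier G" if "t \<in> T" "c \<in> ?C" for t c
    using that P.rcosets_carrier[OF is_group] by (auto simp: T_def)
  have inP: "t c \<otimes> inv (u c) \<in> P" if "t \<in> T" "u \<in> T" "c \<in> ?C" for t u c
  proof -
    have "t c \<in> c" "u c \<in> c" using that by (auto simp: T_def)
    moreover have "c = P #> u c"
    proof -
      obtain x where "x \<in> carrier G" "c = P #> x" using cosE[OF \<open>c \<in> ?C\<close>] by blast
      then show ?thesis using \<open>u c \<in> c\<close> repr_independence[OF _ _ P] by simp
    qed
    ultimately show ?thesis
      using P.rcos_module_imp[OF is_group] carr that by metis
  qed
  have cos: "c #> g \<in> ?C" if "c \<in> ?C" "g \<in> carrier G" for c g
  proof -
    obtain x where "x \<in> carrier G" "c = P #> x" using cosE[OF \<open>c \<in> ?C\<close>] by blast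
    then show ?thesis using that(2) P.subset
      by (auto simp: coset_mult_assoc intro!: rcosetsI)
  qed
  have cos_sub: "c \<subseteq> carrier G" if "c \<in> ?C" for c
    using that P.rcosets_carrier[OF is_group] by blast
  have cos_inv: "c #> g #> inv g = c" "c #> inv g #> g = c" if "c \<in> ?C" "g \<in> carrier G" for c g
    using that cos_sub[OF that(1)] by (simp_all add: coset_mult_assoc)
  have shT: "sh t g \<in> T" if "t \<in> T" "g \<in> carrier G" for t g
    unfolding T_def
  proof safe
    fix c assume c: "c \<in> ?C"
    have "t (c #> inv g) \<in> c #> inv g" using that c cos by (auto simp: T_def)
    then have "sh t g c \<in> c #> inv g #> g" by (auto simp: sh_def r_coset_def)
    then show "sh t g c \<in> c" using cos_inv c that by simp
  qed
  have \<delta>_mult: "\<delta> t u \<otimes> \<delta> u w = \<delta> t w" if "t \<in> T" "u \<in> T" "w \<in> T" for t u w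
  proof -
    have "\<delta> t u \<otimes> \<delta> u w = finprod K (\<lambda>c. (t c \<otimes> inv (u c)) \<otimes> (u c \<otimes> inv (w c))) ?C"
      unfolding \<delta>_def using that inP
      by (subst K.finprod_multf[symmetric, simplified]) auto
    also have "\<dots> = \<delta> t w" unfolding \<delta>_def
    proof (rule K.finprod_cong')
      fix c assume c: "c \<in> ?C"
      show "(t c \<otimes> inv (u c)) \<otimes> (u c \<otimes> inv (w c)) = t c \<otimes> inv (w c)"
        using carr[OF _ c] that by (metis inv_closed inv_solve_left' m_assoc m_closed)
    qed (use inP that in auto)
    finally show ?thesis .
  qed
  have \<delta>_sh: "\<delta> (sh t g) (sh u g) = \<delta> t u" if "t \<in> T" "u \<in> T" "g \<in> carrier G" for t u g
  proof -
    have bij: "inj_on (\<lambda>c. c #> inv g) ?C" "(\<lambda>c. c #> inv g) ` ?C = ?C"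
      using cos_inv[OF _ that(3)] cos that(3)
      by (auto intro: inj_on_inverseI[where g = "\<lambda>c. c #> g"])
         (metis (no_types, lifting) imageI)
    have "\<delta> t u = finprod K (\<lambda>c. t c \<otimes> inv (u c)) ((\<lambda>c. c #> inv g) ` ?C)"
      unfolding \<delta>_def bij ..
    also have "\<dots> = finprod K (\<lambda>c. t (c #> inv g) \<otimes> inv (u (c #> inv g))) ?C"
      by (rule K.finprod_reindex) (use bij inP that in auto)
    also have "\<dots> = \<delta> (sh t g) (sh u g)" unfolding \<delta>_def
    proof (rule K.finprod_cong')
      fix c assume c: "c \<in> ?C"
      then have "t (c #> inv g) \<in> carrier G" "u (c #> inv g) \<in> carrier G"
        using carr cos that by auto
      then show "t (c #> inv g) \<otimes> inv (u (c #> inv g)) = sh t g c \<otimes> inv (sh u g c)"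
        using that(3) unfolding sh_def
        by (simp add: inv_mult_group m_assoc) (simp flip: m_assoc)
    qed (use inP shT that in auto)
    finally show ?thesis ..
  qed
  have sh_sh: "sh (sh t g) h c = sh t (g \<otimes> h) c"
    if "t \<in> T" "g \<in> carrier G" "h \<in> carrier G" "c \<in> ?C" for t g h c
  proof -
    have "c #> inv h #> inv g = c #> inv (g \<otimes> h)"
      using that cos_sub[OF that(4)] by (simp add: coset_mult_assoc inv_mult_group)
    moreover have "t (c #> inv (g \<otimes> h)) \<in> carrier G" using that carr cos by auto
    ultimately show ?thesis using that by (simp add: sh_def m_assoc)
  qed
  obtain t where t: "t \<in> T"
  proof
    show "(\<lambda>c. SOME x. x \<in> c) \<in> T"
      unfolding T_def using P.rcosets_non_empty by (auto simp: some_in_eq)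
  qed
  define V where "V g = \<delta> (sh t g) t" for g
  have V_closed: "V g \<in> P" if "g \<in> carrier G" for g
    unfolding V_def \<delta>_def using K.finprod_closed[of "\<lambda>c. sh t g c \<otimes> inv (t c)" ?C] inP shT t that by auto
  have V_hom: "V \<in> hom G K"
  proof (rule homI)
    fix g h assume gh: "g \<in> carrier G" "h \<in> carrier G"
    have "V (g \<otimes> h) = \<delta> (sh (sh t g) h) t"
      unfolding V_def \<delta>_def
      by (rule K.finprod_cong') (use inP shT t gh sh_sh in auto)
    also have "\<dots> = \<delta> (sh (sh t g) h) (sh t h) \<otimes> \<delta> (sh t h) t"
      using \<delta>_mult shT t gh by simp
    also have "\<dots> = V g \<otimes> V h" unfolding V_def using \<delta>_sh shT t gh by simp
    finally show "V (g \<otimes> h) = V g \<otimes>\<^bsub>K\<^esub> V h" by simp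
  qed (use V_closed in simp)
  have zG: "z \<in> carrier G" using zP by simp
  have "V z = \<one>\<^bsub>K\<^esub>"
    by (rule perfect_group_hom_commuting_image[OF perf K.is_group V_hom _ zG])
       (use V_closed comm in auto)
  moreover have "V z = z [^]\<^bsub>K\<^esub> card ?C"
  proof -
    have "V z = finprod K (\<lambda>c. z) ?C" unfolding V_def \<delta>_def
    proof (rule K.finprod_cong')
      fix c assume c: "c \<in> ?C"
      then obtain x where x: "x \<in> carrier G" "c = P #> x" by (auto simp: RCOSETS_def)
      have "c #> inv z = P #> (x \<otimes> inv z)" using x zG P.subset by (simp add: coset_mult_assoc)
      also have "x \<otimes> inv z = inv z \<otimes> x"
        using central[OF x(1)] x(1) zG by (metis inv_closed inv_solve_left inv_solve_right' m_assoc m_closed)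
      also have "P #> (inv z \<otimes> x) = c"
        using x zG zP P.subset by (simp add: coset_mult_assoc[symmetric] coset_join2[OF _ P])
      finally have "c #> inv z = c" .
      moreover have "t c \<in> carrier G" using carr t c by blast
      ultimately show "sh t z c \<otimes> inv (t c) = z"
        using central[of "t c"] zG by (simp add: sh_def) (metis inv_solve_right m_closed)
    qed (use zP in auto)
    also have "\<dots> = z [^]\<^bsub>K\<^esub> card ?C" by (rule K.finprod_const) (simp add: zP)
    finally show ?thesis .
  qed
  ultimately show ?thesis
    using nat_pow_consistent[of z "card ?C" P] by (simp add: K_def)
qed

lemma perfect_group_no_central_prime_order:
  fixes G (structure)
  assumes perf: "perfect_group G" and fin: "finite (carrier G)" and P: "subgroup P G"
    and comm: "\<And>x y. x \<in> P \<Longrightarrow> y \<in> P \<Longrightarrow> x \<otimes> y = y \<otimes> x"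
    and p: "Factorial_Ring.prime p" and index: "\<not> p dvd card (rcosets P)"
    and zP: "z \<in> P" and central: "\<And>g. g \<in> carrier G \<Longrightarrow> z \<otimes> g = g \<otimes> z"
    and pow: "z [^] p = \<one>"
  shows "z = \<one>"
proof -
  interpret group G using perf by (simp add: perfect_group_def)
  have zG: "z \<in> carrier G" using zP P subgroup.mem_carrier by metis
  have "ord z dvd p" using pow pow_eq_id[OF zG] by simp
  moreover have "ord z dvd card (rcosets P)"
    using perfect_group_central_pow_index[OF perf fin P comm zP central] pow_eq_id[OF zG] by simp
  ultimately have "ord z = 1" using p index by (auto simp: prime_nat_iff)
  then show ?thesis using ord_eq_1[OF zG] by simp
qed

section \<open>Perfect groups have no orbits of size two or three\<close>

lemma even_permutes_card_le_2:
  assumes "q permutes A" "finite A" "card A \<le> 2" "sign q = 1"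
  shows "q = id"
proof -
  consider "A = {}" | a where "A = {a}" | a b where "A = {a, b}" "a \<noteq> b"
    using assms(2,3) by (metis One_nat_def card_0_eq card_1_singletonE card_2_iff le_Suc_eq le_zero_eq
        numeral_2_eq_2)
  then show ?thesis
  proof cases
    case 3
    then have "q = id \<or> q = Transposition.transpose a b" using assms(1) permutes_doubleton_iff by metis
    with assms(4) 3 show ?thesis by (auto simp: sign_swap_id)
  qed (use assms(1) in \<open>auto simp: permutes_sing\<close>)
qed

text \<open>Every element acts on the orbit as an even permutation, the sign being a homomorphism into an
abelian group. An even permutation of at most three points that fixes one of them is the identity, so the
stabilizer of a point is the kernel of the action on the orbit, hence normal; its index is 2 or 3 unless the orbit is a
single point.\<close>

lemma (in group_action) perfect_group_small_orbit_trivial: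
  assumes perf: "perfect_group G" and fin: "finite (carrier G)" and x: "x \<in> E"
    and small: "card (orbit G \<phi> x) \<le> 3"
  shows "orbit G \<phi> x = {x}"
proof (rule ccontr)
  interpret G: group G using perf by (simp add: perfect_group_def)
  let ?O = "orbit G \<phi> x"
  assume "?O \<noteq> {x}"
  have O: "?O = (\<lambda>g. \<phi> g x) ` carrier G" by (auto simp: orbit_def)
  have finO: "finite ?O" unfolding O using fin by simp
  have xO: "x \<in> ?O" using orbit_refl[OF x] .
  have subE: "?O \<subseteq> E" using element_image x by (auto simp: orbit_def)
  have mapO: "\<phi> g y \<in> ?O" if "g \<in> carrier G" "y \<in> ?O" for g y
  proof -
    obtain h where h: "h \<in> carrier G" "y = \<phi> h x" using \<open>y \<in> ?O\<close> unfolding O by blast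
    then have "\<phi> g y = \<phi> (g \<otimes> h) x" using composition_rule[OF x that(1)] by simp
    then show ?thesis using h that(1) O by auto
  qed
  have "card ?O \<noteq> 0" using finO xO by auto
  moreover have "card ?O \<noteq> 1" using xO \<open>?O \<noteq> {x}\<close> by (auto simp: card_1_singleton_iff)
  ultimately have "card ?O = 2 \<or> card ?O = 3" using small by linarith
  then have prime: "Factorial_Ring.prime (card ?O)" by (auto simp: two_is_prime_nat)
  define f where "f g y = (if y \<in> ?O then \<phi> g y else y)" for g y
  have inj: "inj_on (\<phi> g) E" if "g \<in> carrier G" for g using inj_prop[OF that] .
  have perm: "f g permutes ?O" if "g \<in> carrier G" for g
  proof (rule bij_imp_permutes)
    have "inj_on (f g) ?O" using inj[OF that] subE by (auto simp: inj_on_def f_def)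
    moreover have "f g ` ?O \<subseteq> ?O" using mapO that by (auto simp: f_def)
    ultimately show "bij_betw (f g) ?O ?O"
      using finO by (simp add: bij_betw_def endo_inj_surj)
  qed (simp add: f_def)
  have comp: "f (g \<otimes> h) = f g \<circ> f h" if "g \<in> carrier G" "h \<in> carrier G" for g h
    using that mapO composition_rule subE by (auto simp: f_def fun_eq_iff)
  have one: "f \<one> = id"
    using id_eq_one subE by (auto simp: f_def fun_eq_iff) (metis restrict_apply subsetD)
  have sgn: "sign (f g) = 1" if "g \<in> carrier G" for g
  proof -
    have "[sign (f g) = 1] (mod 0)"
    proof (rule perfect_group_mult_mod[OF perf _ _ that])
      fix g h assume gh: "g \<in> carrier G" "h \<in> carrier G"
      have "permutation (f g)" "permutation (f h)"
        using perm gh finO permutation_permutes by blast+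
      then show "[sign (f (g \<otimes> h)) = sign (f g) * sign (f h)] (mod 0)"
        by (simp add: comp[OF gh] sign_compose)
    qed (simp add: one)
    then show ?thesis by simp
  qed
  let ?K = "stabilizer G \<phi> x"
  have K_id: "f g = id" if "g \<in> ?K" for g
  proof -
    have g: "g \<in> carrier G" "f g x = x" using that xO by (auto simp: stabilizer_def f_def)
    have "f g permutes (?O - {x})"
      by (rule permutes_superset[OF perm[OF g(1)]]) (use g(2) in auto)
    moreover have "card (?O - {x}) \<le> 2" using small xO finO by simp
    ultimately show ?thesis
      using finO by (intro even_permutes_card_le_2[OF _ _ _ sgn[OF g(1)]]) auto
  qed
  have K_eq: "g \<in> ?K" if "g \<in> carrier G" "f g = id" for g
  proof -
    have "f g x = x" using that(2) by simp
    then show ?thesis using that(1) xO by (simp add: stabilizer_def f_def)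
  qed
  have sub: "subgroup ?K G" by (rule stabilizer_subgroup[OF x])
  have normal: "?K \<lhd> G"
  proof (rule G.normal_invI[OF sub])
    fix g k assume g: "g \<in> carrier G" and k: "k \<in> ?K"
    then have kG: "k \<in> carrier G" using subgroup.mem_carrier[OF sub] by blast
    have "f (g \<otimes> k \<otimes> inv g) = f g \<circ> f (inv g)"
      using g kG K_id[OF k] by (simp add: comp)
    also have "\<dots> = id" using comp[of g "inv g"] g one by simp
    finally show "g \<otimes> k \<otimes> inv g \<in> ?K" using K_eq g kG by simp
  qed
  have "card (rcosets ?K) = card ?O"
  proof -
    have "card ?O * card ?K = order G" by (rule orbit_stabilizer_theorem[OF x])
    moreover have "card (rcosets ?K) * card ?K = order G" by (rule G.lagrange[OF sub])
    moreover have "card ?K \<noteq> 0" using fin subgroup.finite_imp_card_positive[OF sub] by simp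
    ultimately show ?thesis by (metis mult_right_cancel)
  qed
  then show False using perfect_group_no_normal_prime_index[OF perf normal] prime by simp
qed

section \<open>The class equation of an icosahedral rotation group\<close>

text \<open>Divided by \<open>M\<close> the equation reads \<open>1/n1 + 1/n2 + 1/n3 = 1 + 1/M\<close>. Its solutions are
\<open>(2, 2, n)\<close>, \<open>(2, 3, 3)\<close>, \<open>(2, 3, 4)\<close> and \<open>(2, 3, 5)\<close>, and the bounds on \<open>c2\<close> and \<open>c3\<close> leave the
last one.\<close>

lemma unit_fraction_triple_sorted:
  fixes M :: nat
  assumes "n1 * c1 = M" "n2 * c2 = M" "n3 * c3 = M" "c1 + c2 + c3 = M + 1"
    and n: "2 \<le> n1" "n1 \<le> n2" "n2 \<le> n3" and c: "4 \<le> c2" "4 \<le> c3"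
  shows "M = 30"
proof -
  have le: "k * c1 \<le> M" if "k \<le> n1" for k using assms(1) that mult_le_mono1 by blast
  have le2: "k * c2 \<le> M" if "k \<le> n2" for k using assms(2) that mult_le_mono1 by blast
  have le3: "k * c3 \<le> M" if "k \<le> n3" for k using assms(3) that mult_le_mono1 by blast
  have n1: "n1 = 2"
  proof (rule ccontr)
    assume "n1 \<noteq> 2"
    with n have "3 \<le> n1" by linarith
    with n le[of 3] le2[of 3] le3[of 3] assms(4) show False by linarith
  qed
  then have c1: "2 * c1 = M" using assms(1) by simp
  have n2: "n2 = 3"
  proof (rule ccontr)
    assume "n2 \<noteq> 3"
    with n n1 consider "n2 = 2" | "4 \<le> n2" by linarith
    then show False
    proof cases
      case 1 with assms(2,4) c1 c show False by simp
    next
      case 2 with n c1 le2[of 4] le3[of 4] assms(4) show False by linarith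
    qed
  qed
  then have c2: "3 * c2 = M" using assms(2) by simp
  have "n3 \<le> 5"
  proof (rule ccontr)
    assume "\<not> n3 \<le> 5"
    with le3[of 6] c1 c2 assms(4) show False by linarith
  qed
  with n n2 consider "n3 = 3" | "n3 = 4" | "n3 = 5" by linarith
  then show ?thesis using assms(3,4) c1 c2 c by cases simp_all
qed

lemma unit_fraction_triple:
  fixes M :: nat
  assumes "n1 * c1 = M" "n2 * c2 = M" "n3 * c3 = M" "c1 + c2 + c3 = M + 1"
    and n: "2 \<le> n1" "2 \<le> n2" "2 \<le> n3" and c: "4 \<le> c1" "4 \<le> c2" "4 \<le> c3"
  shows "M = 30"
proof -
  note T = unit_fraction_triple_sorted
  have s: "c1 + c3 + c2 = M + 1" "c2 + c1 + c3 = M + 1" "c2 + c3 + c1 = M + 1"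
    "c3 + c1 + c2 = M + 1" "c3 + c2 + c1 = M + 1" using assms(4) by simp_all
  consider "n1 \<le> n2" "n2 \<le> n3" | "n1 \<le> n3" "n3 \<le> n2" | "n2 \<le> n1" "n1 \<le> n3"
    | "n2 \<le> n3" "n3 \<le> n1" | "n3 \<le> n1" "n1 \<le> n2" | "n3 \<le> n2" "n2 \<le> n1" by linarith
  then show ?thesis
  proof cases
    case 1 show ?thesis by (rule T[OF assms(1,2,3) assms(4) n(1) 1 c(2,3)])
  next case 2 show ?thesis by (rule T[OF assms(1,3,2) s(1) n(1) 2 c(3,2)])
  next case 3 show ?thesis by (rule T[OF assms(2,1,3) s(2) n(2) 3 c(1,3)])
  next case 4 show ?thesis by (rule T[OF assms(2,3,1) s(3) n(2) 4 c(3,1)])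
  next case 5 show ?thesis by (rule T[OF assms(3,1,2) s(4) n(3) 5 c(1,2)])
  next case 6 show ?thesis by (rule T[OF assms(3,2,1) s(5) n(3) 6 c(2,1)])
  qed
qed

text \<open>The equation says \<open>1/n1 + 1/(2 n2) = 1/2 + 1/m\<close>, which leaves \<open>n1 = 2\<close> with \<open>c2 = 1\<close>
(a dihedral group of twice odd order) or \<open>(n1, n2) = (3, 2)\<close> with \<open>c2 = 3\<close> (the tetrahedral group).\<close>

lemma unit_fraction_pair_impossible:
  fixes m :: nat
  assumes "n1 * c1 = m" "2 * n2 * c2 = m" "2 * c1 + 2 * c2 = m + 2"
    and n: "2 \<le> n1" "2 \<le> n2" and c: "4 \<le> c2"
  shows False
proof -
  have le: "k * c1 \<le> m" if "k \<le> n1" for k using assms(1) that mult_le_mono1 by blast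
  have le2: "2 * k * c2 \<le> m" if "k \<le> n2" for k
    using assms(2) that mult_le_mono1[of "2 * k" "2 * n2" c2] by simp
  have "n1 < 4" using le[of 4] le2[of 2] n assms(3) by fastforce
  with n consider "n1 = 2" | "n1 = 3" by linarith
  then show False
  proof cases
    case 1 with assms(1,3) c show False by simp
  next
    case 2
    then have c1: "3 * c1 = m" using assms(1) by simp
    have "n2 < 3" using le2[of 3] c1 assms(3) by fastforce
    with n have "4 * c2 = m" using assms(2) by (simp add: numeral_eq_Suc le_Suc_eq less_Suc_eq)
    with c1 assms(3) c show False by linarith
  qed
qed

text \<open>Here \<open>I\<close> indexes conjugacy classes of maximal abelian subgroups of a group of order \<open>m\<close>: a
class has \<open>c i\<close> members, each of order \<open>n i\<close> and of index \<open>e i\<close> in its normalizer, and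
\<open>eq\<close> counts the non-identity elements. Each class contributes at least a quarter of \<open>m\<close>, so there are at
most three. Only three classes with all \<open>e i = 2\<close> are possible, as a class with \<open>e i = 1\<close> contributes at
least half.\<close>

theorem icosahedral_class_equation:
  fixes e n c :: "'i \<Rightarrow> nat" and m :: nat
  assumes fin: "finite I" and e: "\<And>i. i \<in> I \<Longrightarrow> e i = 1 \<or> e i = 2"
    and n: "\<And>i. i \<in> I \<Longrightarrow> 2 \<le> n i" and c: "\<And>i. i \<in> I \<Longrightarrow> 4 \<le> c i"
    and m: "\<And>i. i \<in> I \<Longrightarrow> e i * n i * c i = m"
    and eq: "m = 1 + (\<Sum>i\<in>I. c i * (n i - 1))" and "1 < m"
  shows "m = 60"
proof -
  have diff: "c i * (n i - 1) + c i = n i * c i" if "i \<in> I" for i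
    using n[OF that] by (cases "n i") (auto simp: algebra_simps)
  have quarter: "m \<le> 4 * (c i * (n i - 1))" if "i \<in> I" for i
  proof -
    have "m \<le> 2 * (n i * c i)" using m[OF that] e[OF that] by auto
    moreover have "2 * c i \<le> n i * c i" using n[OF that] by simp
    ultimately show ?thesis using diff[OF that] by linarith
  qed
  have "card I \<le> 3"
  proof (rule ccontr)
    assume "\<not> card I \<le> 3"
    then have "4 * m \<le> card I * m" by simp
    also have "\<dots> = (\<Sum>i\<in>I. m)" by simp
    also have "\<dots> \<le> (\<Sum>i\<in>I. 4 * (c i * (n i - 1)))" by (rule sum_mono) (rule quarter)
    also have "\<dots> = 4 * (\<Sum>i\<in>I. c i * (n i - 1))" by (simp add: sum_distrib_left)
    finally show False using eq by linarith
  qed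
  then consider "I = {}" | i where "I = {i}" | i j where "I = {i, j}" "i \<noteq> j"
    | i j k where "I = {i, j, k}" "i \<noteq> j" "j \<noteq> k" "i \<noteq> k"
    using fin card_1_singletonE card_2_iff card_3_iff
    by (metis One_nat_def card_0_eq le_Suc_eq le_zero_eq numeral_2_eq_2 numeral_3_eq_3)
  then show ?thesis
  proof cases
    case 1 with eq \<open>1 < m\<close> show ?thesis by simp
  next
    case 2
    then have i: "i \<in> I" and "m + c i = 1 + n i * c i" using eq diff[of i] by auto
    with e[OF i] m[OF i] c[OF i] show ?thesis by auto
  next
    case 3
    then have i: "i \<in> I" and j: "j \<in> I" by auto
    have sum: "m + c i + c j = 1 + n i * c i + n j * c j"
      using eq 3 diff[OF i] diff[OF j] by simp
    have small: "2 * c i \<le> n i * c i" "2 * c j \<le> n j * c j" using n[OF i] n[OF j] by simp_all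
    consider "e i = 1" "e j = 1" | "e i = 1" "e j = 2" | "e i = 2" "e j = 1" | "e i = 2" "e j = 2"
      using e[OF i] e[OF j] by blast
    then show ?thesis
    proof cases
      case 1 with m[OF i] m[OF j] sum small \<open>1 < m\<close> show ?thesis by simp
    next
      case 2
      with sum m[OF i] m[OF j] have "2 * c i + 2 * c j = m + 2" by simp
      with 2 m[OF i] m[OF j] n[OF i] n[OF j] c[OF j]
      show ?thesis using unit_fraction_pair_impossible[of "n i" "c i" m "n j" "c j"] by simp
    next
      case 3
      with sum m[OF i] m[OF j] have "2 * c j + 2 * c i = m + 2" by simp
      with 3 m[OF i] m[OF j] n[OF i] n[OF j] c[OF i]
      show ?thesis using unit_fraction_pair_impossible[of "n j" "c j" m "n i" "c i"] by simp
    next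
      case 4 with m[OF i] m[OF j] sum c[OF i] show ?thesis by simp
    qed
  next
    case 4
    then have i: "i \<in> I" and j: "j \<in> I" and k: "k \<in> I" by auto
    have sum: "m + c i + c j + c k = 1 + n i * c i + n j * c j + n k * c k"
      using eq 4 diff[OF i] diff[OF j] diff[OF k] by simp
    have small: "2 * c i \<le> n i * c i" "2 * c j \<le> n j * c j" "2 * c k \<le> n k * c k"
      using n[OF i] n[OF j] n[OF k] by simp_all
    have ge: "m \<le> 2 * (n i * c i)" "m \<le> 2 * (n j * c j)" "m \<le> 2 * (n k * c k)"
      using e[OF i] m[OF i] e[OF j] m[OF j] e[OF k] m[OF k] by auto
    have "n i * c i \<noteq> m" "n j * c j \<noteq> m" "n k * c k \<noteq> m"
      using sum small ge by linarith+
    with m[OF i] m[OF j] m[OF k] have e2: "e i = 2" "e j = 2" "e k = 2"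
      using e[OF i] e[OF j] e[OF k] by auto
    with m[OF i] m[OF j] m[OF k] have M: "2 * (n i * c i) = m" "n j * c j = n i * c i" "n k * c k = n i * c i"
      by simp_all
    have "n i * c i = 30"
      by (rule unit_fraction_triple[OF refl M(2,3)])
         (use sum M n[OF i] n[OF j] n[OF k] c[OF i] c[OF j] c[OF k] in auto)
    with M show ?thesis by simp
  qed
qed

section \<open>Perfect groups with abelian centralizers\<close>

definition group_center :: "('a, 'b) monoid_scheme \<Rightarrow> 'a set" where
  "group_center G = {z \<in> carrier G. \<forall>x\<in>carrier G. z \<otimes>\<^bsub>G\<^esub> x = x \<otimes>\<^bsub>G\<^esub> z}"

definition elt_centralizer :: "('a, 'b) monoid_scheme \<Rightarrow> 'a \<Rightarrow> 'a set" where
  "elt_centralizer G x = {y \<in> carrier G. x \<otimes>\<^bsub>G\<^esub> y = y \<otimes>\<^bsub>G\<^esub> x}"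

lemma (in group) subgroup_elt_centralizer:
  assumes "x \<in> carrier G"
  shows "subgroup (elt_centralizer G x) G"
proof (rule subgroupI)
  fix a assume "a \<in> elt_centralizer G x"
  then show "inv a \<in> elt_centralizer G x"
    using assms by (auto simp: elt_centralizer_def) (metis inv_closed inv_solve_left inv_solve_right' m_assoc m_closed)
next
  fix a b assume "a \<in> elt_centralizer G x" "b \<in> elt_centralizer G x"
  then show "a \<otimes> b \<in> elt_centralizer G x"
    using assms by (auto simp: elt_centralizer_def) (metis m_assoc)
qed (use assms in \<open>auto simp: elt_centralizer_def\<close>)

lemma (in group) group_center_eq_Inter:
  "group_center G = carrier G \<inter> (\<Inter>x\<in>carrier G. elt_centralizer G x)"
  by (auto simp: group_center_def elt_centralizer_def)

lemma (in group) subgroup_group_center: "subgroup (group_center G) G"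
proof -
  have "group_center G = (\<Inter>x\<in>carrier G. elt_centralizer G x)"
    unfolding group_center_eq_Inter by (auto simp: elt_centralizer_def)
  then show ?thesis
    using subgroups_Inter[of "elt_centralizer G ` carrier G"] subgroup_elt_centralizer by fastforce
qed

lemma (in group) conj_commute_iff:
  assumes "g \<in> carrier G" "x \<in> carrier G" "y \<in> carrier G"
  shows "(g \<otimes> x \<otimes> inv g) \<otimes> (g \<otimes> y \<otimes> inv g) = (g \<otimes> y \<otimes> inv g) \<otimes> (g \<otimes> x \<otimes> inv g)
    \<longleftrightarrow> x \<otimes> y = y \<otimes> x"
proof -
  have m: "(g \<otimes> u \<otimes> inv g) \<otimes> (g \<otimes> v \<otimes> inv g) = g \<otimes> (u \<otimes> v) \<otimes> inv g"
    if "u \<in> carrier G" "v \<in> carrier G" for u v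
    using that assms(1) by (simp add: m_assoc inv_solve_left')
  show ?thesis using assms by (simp add: m)
qed

lemma (in group) elt_centralizer_conj:
  assumes g: "g \<in> carrier G" and x: "x \<in> carrier G"
  shows "g <# elt_centralizer G x #> inv g = elt_centralizer G (g \<otimes> x \<otimes> inv g)"
proof
  show "g <# elt_centralizer G x #> inv g \<subseteq> elt_centralizer G (g \<otimes> x \<otimes> inv g)"
    using assms conj_commute_iff[OF g x] by (auto simp: l_coset_def r_coset_def elt_centralizer_def)
next
  show "elt_centralizer G (g \<otimes> x \<otimes> inv g) \<subseteq> g <# elt_centralizer G x #> inv g"
  proof
    fix y assume y: "y \<in> elt_centralizer G (g \<otimes> x \<otimes> inv g)"
    define w where "w = inv g \<otimes> y \<otimes> g"
    have yG: "y \<in> carrier G" using y by (simp add: elt_centralizer_def)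
    have w: "w \<in> carrier G" "y = g \<otimes> w \<otimes> inv g"
      using g yG by (auto simp: w_def m_assoc) (simp flip: m_assoc)
    then have "w \<in> elt_centralizer G x"
      using y conj_commute_iff[OF g x w(1)] by (simp add: elt_centralizer_def)
    then show "y \<in> g <# elt_centralizer G x #> inv g"
      unfolding w(2) by (auto simp: l_coset_def r_coset_def)
  qed
qed

lemma (in group) conj_mem_center_iff:
  assumes "g \<in> carrier G" "x \<in> carrier G"
  shows "g \<otimes> x \<otimes> inv g \<in> group_center G \<longleftrightarrow> x \<in> group_center G"
proof
  assume "x \<in> group_center G"
  then have "g \<otimes> x \<otimes> inv g = x" using assms
    by (auto simp: group_center_def) (metis inv_closed inv_solve_right' m_closed)
  with \<open>x \<in> group_center G\<close> show "g \<otimes> x \<otimes> inv g \<in> group_center G" by simp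
next
  assume *: "g \<otimes> x \<otimes> inv g \<in> group_center G"
  have "g \<otimes> x \<otimes> inv g = x"
  proof -
    have "(g \<otimes> x \<otimes> inv g) \<otimes> g = g \<otimes> (g \<otimes> x \<otimes> inv g)" using * assms by (simp add: group_center_def)
    then have "g \<otimes> x = g \<otimes> (g \<otimes> x \<otimes> inv g)" using assms by (simp add: m_assoc)
    then show ?thesis using assms by simp
  qed
  with * show "x \<in> group_center G" by simp
qed

lemma perfect_group_center_proper:
  fixes G (structure)
  assumes perf: "perfect_group G" and "carrier G \<noteq> {\<one>}"
  shows "group_center G \<noteq> carrier G"
proof
  interpret group G using perf by (simp add: perfect_group_def)
  assume "group_center G = carrier G"
  then have "g \<otimes> h = h \<otimes> g" if "g \<in> carrier G" "h \<in> carrier G" for g h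
    using that by (auto simp: group_center_def)
  then have "x = \<one>" if "x \<in> carrier G" for x
    using perfect_group_hom_commuting_image[OF perf is_group, of "\<lambda>x. x" x] that by (auto simp: hom_def)
  with assms(2) show False by auto
qed

lemma (in group) card_subgroup_dvd:
  assumes "subgroup A G" "subgroup B G" "A \<subseteq> B"
  shows "card A dvd card B"
proof -
  have "subgroup A (G\<lparr>carrier := B\<rparr>)" using assms subgroup_incl by blast
  from group.lagrange[OF subgroup_imp_group[OF assms(2)] this]
  have "card (rcosets\<^bsub>G\<lparr>carrier := B\<rparr>\<^esub> A) * card A = card B" by (simp add: order_def)
  then show ?thesis using dvd_triv_right[of "card A"] by metis
qed

text \<open>The class equation is applied to the quotient by the centre, without forming it: \<open>m\<close> is the
index of the centre, and \<open>n\<close> is the index of the centre in a centralizer of a noncentral element. These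
centralizers are pairwise disjoint outside the centre, because two noncentral elements that commute have the
same centralizer.\<close>

theorem perfect_group_abelian_centralizers_order:
  fixes G (structure)
  assumes perf: "perfect_group G" and fin: "finite (carrier G)" and nontriv: "carrier G \<noteq> {\<one>}"
    and abel: "\<And>x y w. \<lbrakk>x \<in> carrier G; x \<notin> group_center G; y \<in> elt_centralizer G x;
      w \<in> elt_centralizer G x\<rbrakk> \<Longrightarrow> y \<otimes> w = w \<otimes> y"
    and inv: "\<And>x g. \<lbrakk>x \<in> carrier G; x \<notin> group_center G; g \<in> carrier G;
      g \<otimes> x \<otimes> inv g \<in> elt_centralizer G x\<rbrakk> \<Longrightarrow> g \<otimes> x \<otimes> inv g = x \<or> g \<otimes> x \<otimes> inv g = inv x"
  shows "order G = 60 * card (group_center G)"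
proof -
  interpret group G using perf by (simp add: perfect_group_def)
  let ?Z = "group_center G" and ?C = "elt_centralizer G"
  have subZ: "subgroup ?Z G" by (rule subgroup_group_center)
  have subC: "subgroup (?C x) G" if "x \<in> carrier G" for x using subgroup_elt_centralizer[OF that] .
  have CG: "?C x \<subseteq> carrier G" for x by (auto simp: elt_centralizer_def)
  have ZC: "?Z \<subseteq> ?C x" if "x \<in> carrier G" for x
    using that by (auto simp: group_center_def elt_centralizer_def)
  have xC: "x \<in> ?C x" if "x \<in> carrier G" for x using that by (simp add: elt_centralizer_def)
  have finC: "finite (?C x)" for x using fin CG finite_subset by blast
  have finZ: "finite ?Z" using fin subgroup.subset[OF subZ] finite_subset by blast
  have Zpos: "0 < card ?Z" using subgroup.finite_imp_card_positive[OF subZ fin] .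
  have C_eq: "?C y = ?C x" if x: "x \<in> carrier G" "x \<notin> ?Z" and y: "y \<in> ?C x" "y \<notin> ?Z" for x y
  proof -
    have yG: "y \<in> carrier G" using y CG by blast
    have xy: "x \<in> ?C y" using y x by (simp add: elt_centralizer_def)
    show ?thesis
      using abel[OF x y(1)] abel[OF yG y(2) xy] CG
      by (auto simp: elt_centralizer_def[of G y]) (auto simp: elt_centralizer_def[of G x])
  qed
  define \<A> where "\<A> = ?C ` (carrier G - ?Z)"
  define \<phi> where "\<phi> = (\<lambda>g. \<lambda>H\<in>{H. H \<subseteq> carrier G}. g <# H #> inv g)"
  interpret act: group_action G "{H. H \<subseteq> carrier G}" \<phi>
    unfolding \<phi>_def by (rule action_by_conjugation_on_power_set)
  have \<phi>_C: "\<phi> g (?C x) = ?C (g \<otimes> x \<otimes> inv g)" if "g \<in> carrier G" "x \<in> carrier G" for g x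
    using that CG by (simp add: \<phi>_def elt_centralizer_conj)
  have finA: "finite \<A>" using fin by (simp add: \<A>_def)
  have AE: "\<A> \<subseteq> {H. H \<subseteq> carrier G}" using CG by (auto simp: \<A>_def)
  have \<phi>_A: "\<phi> g A \<in> \<A>" if "g \<in> carrier G" "A \<in> \<A>" for g A
    using that conj_mem_center_iff \<phi>_C by (auto simp: \<A>_def)
  let ?orb = "orbit G \<phi>"
  have orbA: "?orb A \<subseteq> \<A>" if "A \<in> \<A>" for A using \<phi>_A[OF _ that] by (auto simp: orbit_def)
  have card_orb: "card B = card A" if "A \<in> \<A>" "B \<in> ?orb A" for A B
  proof -
    obtain g x where gx: "g \<in> carrier G" "B = \<phi> g A" "x \<in> carrier G" "A = ?C x"
      using \<open>A \<in> \<A>\<close> \<open>B \<in> ?orb A\<close> unfolding orbit_def \<A>_def by blast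
    have "bij_betw (\<lambda>y. g \<otimes> y \<otimes> inv g) A B"
    proof (rule bij_betw_imageI)
      show "inj_on (\<lambda>y. g \<otimes> y \<otimes> inv g) A"
      proof (rule inj_onI)
        fix u v assume "u \<in> A" "v \<in> A" "g \<otimes> u \<otimes> inv g = g \<otimes> v \<otimes> inv g"
        moreover from this have "u \<in> carrier G" "v \<in> carrier G" using gx(4) CG by blast+
        ultimately show "u = v" using gx(1) by simp
      qed
      show "(\<lambda>y. g \<otimes> y \<otimes> inv g) ` A = B"
        using gx CG by (auto simp: \<phi>_def l_coset_def r_coset_def)
    qed
    then show ?thesis using bij_betw_same_card by metis
  qed
  \<comment> \<open>The stabilizer of the centralizer of x moves x only to x or its inverse, and two elements that both
    invert x differ by an element of the centralizer.\<close>
  have stab: "\<exists>e. (e = 1 \<or> e = 2) \<and> card (stabilizer G \<phi> A) = e * card A" if "A \<in> \<A>" for A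
  proof -
    obtain x where x: "x \<in> carrier G" "x \<notin> ?Z" "A = ?C x" using \<open>A \<in> \<A>\<close> unfolding \<A>_def by blast
    let ?N = "stabilizer G \<phi> A"
    have N: "subgroup ?N G" using act.stabilizer_subgroup that AE by blast
    have conj: "g \<otimes> x \<otimes> inv g = x \<or> g \<otimes> x \<otimes> inv g = inv x" if "g \<in> ?N" for g
    proof -
      have g: "g \<in> carrier G" "\<phi> g A = A" using that by (auto simp: stabilizer_def)
      have "g \<otimes> x \<otimes> inv g \<in> ?C x"
        using xC[of "g \<otimes> x \<otimes> inv g"] g x \<phi>_C by simp
      then show ?thesis using inv x g by blast
    qed
    have A_iff: "g \<in> A \<longleftrightarrow> g \<otimes> x \<otimes> inv g = x" if "g \<in> carrier G" for g
      using that x(1) unfolding x(3) elt_centralizer_def by (auto simp: inv_solve_right')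
    have AN: "A \<subseteq> ?N"
    proof
      fix g assume g: "g \<in> A"
      then have gG: "g \<in> carrier G" using x(3) CG by blast
      have "\<phi> g A = ?C (g \<otimes> x \<otimes> inv g)" using \<phi>_C[OF gG x(1)] x(3) by simp
      also have "\<dots> = A" using A_iff[OF gG] g x(3) by simp
      finally show "g \<in> ?N" using gG by (simp add: stabilizer_def)
    qed
    have dvd: "card A dvd card ?N" using card_subgroup_dvd[OF _ N AN] subC x by simp
    have le: "card ?N \<le> 2 * card A"
    proof (cases "?N \<subseteq> A")
      case True
      then have "card ?N \<le> card A" using x finC by (intro card_mono) auto
      then show ?thesis by simp
    next
      case False
      then obtain h where h: "h \<in> ?N" "h \<notin> A" by blast
      have hG: "h \<in> carrier G" using h by (simp add: stabilizer_def)
      have "?N \<subseteq> A \<union> (\<lambda>a. h \<otimes> a) ` A"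
      proof
        fix g assume g: "g \<in> ?N"
        then have gG: "g \<in> carrier G" by (simp add: stabilizer_def)
        show "g \<in> A \<union> (\<lambda>a. h \<otimes> a) ` A"
        proof (cases "g \<in> A")
          case False
          then have eq: "g \<otimes> x \<otimes> inv g = h \<otimes> x \<otimes> inv h"
            using conj[OF g] conj[OF h(1)] A_iff[OF gG] A_iff[OF hG] h(2) by metis
          have "(inv h \<otimes> g) \<otimes> x \<otimes> inv (inv h \<otimes> g) = inv h \<otimes> (g \<otimes> x \<otimes> inv g) \<otimes> h"
            using gG hG x by (simp add: inv_mult_group m_assoc)
          also have "\<dots> = x" unfolding eq using hG x by (simp add: m_assoc) (simp flip: m_assoc)
          finally have "inv h \<otimes> g \<in> A" using A_iff gG hG by simp
          moreover have "g = h \<otimes> (inv h \<otimes> g)" using gG hG by (simp flip: m_assoc)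
          ultimately show ?thesis by blast
        qed simp
      qed
      then have "card ?N \<le> card (A \<union> (\<lambda>a. h \<otimes> a) ` A)" using x finC by (intro card_mono) auto
      also have "\<dots> \<le> card A + card ((\<lambda>a. h \<otimes> a) ` A)" by (rule card_Un_le)
      also have "\<dots> \<le> 2 * card A" using card_image_le[of A] x finC by simp
      finally show ?thesis .
    qed
    have pos: "0 < card ?N" "0 < card A"
      using subgroup.finite_imp_card_positive[OF _ fin] N subC x by auto
    obtain e where e: "card ?N = card A * e" using dvd by blast
    then have "e = 1 \<or> e = 2" using le pos by auto
    then show ?thesis using e by (auto simp: mult.commute)
  qed
  define I where "I = ?orb ` \<A>"
  define rep where "rep \<Omega> = (SOME A. A \<in> \<A> \<and> \<Omega> = ?orb A)" for \<Omega>
  have rep: "rep \<Omega> \<in> \<A>" "?orb (rep \<Omega>) = \<Omega>" if "\<Omega> \<in> I" for \<Omega>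
    using that someI_ex[of "\<lambda>A. A \<in> \<A> \<and> \<Omega> = ?orb A"] unfolding I_def rep_def by blast+
  define e where "e \<Omega> = card (stabilizer G \<phi> (rep \<Omega>)) div card (rep \<Omega>)" for \<Omega>
  define n where "n \<Omega> = card (rep \<Omega>) div card ?Z" for \<Omega>
  define m where "m = card (rcosets ?Z)"
  have order_m: "order G = m * card ?Z" unfolding m_def using lagrange[OF subZ] by simp
  have A_props: "card A = card A div card ?Z * card ?Z \<and> 2 \<le> card A div card ?Z \<and> 0 < card A"
    if "A \<in> \<A>" for A
  proof -
    obtain x where x: "x \<in> carrier G" "x \<notin> ?Z" "A = ?C x" using \<open>A \<in> \<A>\<close> by (auto simp: \<A>_def)
    have dvd: "card ?Z dvd card A" using card_subgroup_dvd[OF subZ subC ZC] x by simp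
    have "?Z \<subset> A" using ZC xC x by blast
    then have less: "card ?Z < card A" using psubset_card_mono finC x by metis
    obtain k where k: "card A = card ?Z * k" using dvd by blast
    have "k \<noteq> 0" "k \<noteq> 1" using k less by auto
    then have "2 \<le> k" by linarith
    then show ?thesis using k Zpos by simp
  qed
  have e: "e \<Omega> = 1 \<or> e \<Omega> = 2" "card (stabilizer G \<phi> (rep \<Omega>)) = e \<Omega> * card (rep \<Omega>)" if "\<Omega> \<in> I" for \<Omega>
  proof -
    from stab[OF rep(1)[OF that]]
    obtain e' where "e' = 1 \<or> e' = 2" "card (stabilizer G \<phi> (rep \<Omega>)) = e' * card (rep \<Omega>)"
      by blast
    then show "e \<Omega> = 1 \<or> e \<Omega> = 2" "card (stabilizer G \<phi> (rep \<Omega>)) = e \<Omega> * card (rep \<Omega>)"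
      using A_props[OF rep(1)[OF that]] by (auto simp: e_def)
  qed
  \<comment> \<open>orbit-stabilizer theorem, divided by the order of the centre\<close>
  have prod: "e \<Omega> * n \<Omega> * card \<Omega> = m" if "\<Omega> \<in> I" for \<Omega>
  proof -
    have "card \<Omega> * card (stabilizer G \<phi> (rep \<Omega>)) = order G"
      using act.orbit_stabilizer_theorem[of "rep \<Omega>"] rep[OF that] AE by auto
    then have "card \<Omega> * (e \<Omega> * (n \<Omega> * card ?Z)) = m * card ?Z"
      using e(2)[OF that] A_props[OF rep(1)[OF that]] order_m by (simp add: n_def)
    then show ?thesis using Zpos by (simp add: algebra_simps)
  qed
  \<comment> \<open>An orbit of at most three centralizers is a single normal subgroup of index 1 or 2; index 1
    would make the whole group abelian.\<close>
  have big: "4 \<le> card \<Omega>" if "\<Omega> \<in> I" for \<Omega>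
  proof (rule ccontr)
    let ?A = "rep \<Omega>"
    have A: "?A \<in> \<A>" "?orb ?A = \<Omega>" using rep[OF that] by auto
    assume "\<not> 4 \<le> card \<Omega>"
    then have "card (?orb ?A) \<le> 3" using A(2) by simp
    moreover have "?A \<in> {H. H \<subseteq> carrier G}" using A(1) AE by blast
    ultimately have "?orb ?A = {?A}"
      using act.perfect_group_small_orbit_trivial[OF perf fin] by blast
    then have \<phi>A: "\<phi> g ?A = ?A" if "g \<in> carrier G" for g using that by (auto simp: orbit_def)
    obtain x where x: "x \<in> carrier G" "x \<notin> ?Z" "?A = ?C x" using A(1) by (auto simp: \<A>_def)
    have subA: "subgroup ?A G" using x subC by simp
    have "stabilizer G \<phi> ?A = carrier G" using \<phi>A by (auto simp: stabilizer_def)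
    then have "card (rcosets ?A) * card ?A = e \<Omega> * card ?A"
      using e(2)[OF that] lagrange[OF subA] by (simp add: order_def)
    then have idx: "card (rcosets ?A) = e \<Omega>" using A_props[OF A(1)] by simp
    show False
    proof (cases "e \<Omega> = 1")
      case True
      have "card ?A = card (carrier G)" using idx True lagrange[OF subA] by (simp add: order_def)
      then have "?A = carrier G" using CG x fin by (metis card_subset_eq)
      then have "?Z = carrier G" using abel[OF x(1,2)] x(3) by (auto simp: group_center_def)
      then show False using perfect_group_center_proper[OF perf nontriv] by simp
    next
      case False
      then have 2: "Factorial_Ring.prime (card (rcosets ?A))" using idx e(1)[OF that] by auto
      have "?A \<lhd> G"
      proof (rule normal_invI[OF subA])
        fix g h assume g: "g \<in> carrier G" and h: "h \<in> ?A"
        have "g \<otimes> h \<otimes> inv g \<in> \<phi> g ?A"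
          using g h x CG by (auto simp: \<phi>_def l_coset_def r_coset_def)
        then show "g \<otimes> h \<otimes> inv g \<in> ?A" using \<phi>A[OF g] by simp
      qed
      then show False using perfect_group_no_normal_prime_index[OF perf _ 2] by simp
    qed
  qed
  have count: "m = 1 + (\<Sum>\<Omega>\<in>I. card \<Omega> * (n \<Omega> - 1))"
  proof -
    have disjA: "(A - ?Z) \<inter> (B - ?Z) = {}" if "A \<in> \<A>" "B \<in> \<A>" "A \<noteq> B" for A B
    proof (rule ccontr)
      assume "(A - ?Z) \<inter> (B - ?Z) \<noteq> {}"
      then obtain w where w: "w \<in> A" "w \<in> B" "w \<notin> ?Z" by blast
      obtain x y where "x \<in> carrier G" "x \<notin> ?Z" "A = ?C x" "y \<in> carrier G" "y \<notin> ?Z" "B = ?C y"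
        using \<open>A \<in> \<A>\<close> \<open>B \<in> \<A>\<close> unfolding \<A>_def by blast
      with w C_eq[of x w] C_eq[of y w] \<open>A \<noteq> B\<close> show False by simp
    qed
    have "carrier G - ?Z = (\<Union>A\<in>\<A>. A - ?Z)"
      using xC CG by (auto simp: \<A>_def)
    then have "card (carrier G - ?Z) = (\<Sum>A\<in>\<A>. card (A - ?Z))"
      using card_UN_disjoint[OF finA, of "\<lambda>A. A - ?Z"] disjA finC by (auto simp: \<A>_def)
    also have "\<A> = \<Union>I"
    proof
      show "\<A> \<subseteq> \<Union>I" unfolding I_def using act.orbit_refl AE by blast
      show "\<Union>I \<subseteq> \<A>" unfolding I_def using orbA by blast
    qed
    also have "(\<Sum>A\<in>\<Union>I. card (A - ?Z)) = (\<Sum>\<Omega>\<in>I. \<Sum>A\<in>\<Omega>. card (A - ?Z))"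
    proof -
      have fin: "\<forall>\<Omega>\<in>I. finite \<Omega>" using finite_subset[OF orbA finA] by (auto simp: I_def)
      have disj: "\<forall>\<Omega>\<in>I. \<forall>\<Omega>'\<in>I. \<Omega> \<noteq> \<Omega>' \<longrightarrow> \<Omega> \<inter> \<Omega>' = {}"
      proof (intro ballI impI)
        fix \<Omega> \<Omega>' assume "\<Omega> \<in> I" "\<Omega>' \<in> I" "\<Omega> \<noteq> \<Omega>'"
        moreover from this have "\<Omega> \<in> orbits G {H. H \<subseteq> carrier G} \<phi>" "\<Omega>' \<in> orbits G {H. H \<subseteq> carrier G} \<phi>"
          using AE by (auto simp: I_def orbits_def)
        ultimately show "\<Omega> \<inter> \<Omega>' = {}" using act.disjoint_union by blast
      qed
      show ?thesis using sum.Union_disjoint[OF fin disj] by simp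
    qed
    also have "\<dots> = (\<Sum>\<Omega>\<in>I. card \<Omega> * ((n \<Omega> - 1) * card ?Z))"
    proof (rule sum.cong[OF refl])
      fix \<Omega> assume \<Omega>: "\<Omega> \<in> I"
      have "card (A - ?Z) = (n \<Omega> - 1) * card ?Z" if "A \<in> \<Omega>" for A
      proof -
        have AA: "A \<in> \<A>" using orbA rep[OF \<Omega>] that by blast
        then have "?Z \<subseteq> A" using ZC by (auto simp: \<A>_def)
        then have "card (A - ?Z) = card A - card ?Z" using finZ by (rule card_Diff_subset[rotated])
        also have "card A = card (rep \<Omega>)" using card_orb rep[OF \<Omega>] that by simp
        also have "card (rep \<Omega>) = n \<Omega> * card ?Z" using A_props[OF rep(1)[OF \<Omega>]] by (simp add: n_def)
        finally show ?thesis by (simp add: diff_mult_distrib)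
      qed
      then show "(\<Sum>A\<in>\<Omega>. card (A - ?Z)) = card \<Omega> * ((n \<Omega> - 1) * card ?Z)" by simp
    qed
    also have "\<dots> = (\<Sum>\<Omega>\<in>I. card \<Omega> * (n \<Omega> - 1)) * card ?Z" by (simp add: sum_distrib_right mult.assoc)
    finally have "card (carrier G - ?Z) = (\<Sum>\<Omega>\<in>I. card \<Omega> * (n \<Omega> - 1)) * card ?Z" .
    moreover have "card (carrier G - ?Z) + card ?Z = m * card ?Z"
      using card_Diff_subset[OF finZ subgroup.subset[OF subZ]] order_m
        card_mono[OF fin subgroup.subset[OF subZ]] by (simp add: order_def)
    ultimately have "m * card ?Z = (1 + (\<Sum>\<Omega>\<in>I. card \<Omega> * (n \<Omega> - 1))) * card ?Z"
      by (simp add: algebra_simps)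
    then show ?thesis using Zpos by (metis mult_right_cancel less_numeral_extra(3))
  qed
  have "m \<noteq> 1"
  proof
    assume "m = 1"
    then have "?Z = carrier G" using order_m subgroup.subset[OF subZ] fin
      by (simp add: order_def card_subset_eq)
    then show False using perfect_group_center_proper[OF perf nontriv] by simp
  qed
  then have "1 < m" using count by linarith
  have "m = 60"
    by (rule icosahedral_class_equation[of I e n card m])
       (use finA e(1) big prod count \<open>1 < m\<close> A_props rep in \<open>auto simp: I_def n_def\<close>)
  then show ?thesis using order_m by simp
qed

section \<open>Unimodular two-dimensional representations modulo a prime\<close>

lemma (in group) cauchy:
  assumes fin: "finite (carrier G)" and r: "Factorial_Ring.prime r" and dvd: "r dvd order G"
  shows "\<exists>x\<in>carrier G. ord x = r"
proof -
  obtain k where k: "order G = r ^ 1 * k" using dvd by auto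
  obtain P where P: "subgroup P G" "card P = r" using sylow_thm[OF r is_group k fin] by auto
  have "P \<noteq> {\<one>}" using P(2) prime_gt_1_nat[OF r] by auto
  then obtain x where x: "x \<in> P" "x \<noteq> \<one>" using subgroup.one_closed[OF P(1)] by blast
  then have xG: "x \<in> carrier G" using subgroup.mem_carrier[OF P(1)] by blast
  have "card (generate G {x}) dvd card P"
    by (rule card_subgroup_dvd[OF generate_is_subgroup P(1)])
       (use xG x generate_subgroup_incl[OF _ P(1), of "{x}"] in auto)
  then have "ord x dvd r" using generate_pow_card[OF xG] P(2) by simp
  moreover have "ord x \<noteq> 1" using ord_eq_1[OF xG] x by simp
  ultimately have "ord x = r" using r unfolding prime_nat_iff by blast
  with xG show ?thesis by blast
qed

text \<open>With the next lemma this proves polynomial congruences by exhibiting cofactors: the remaining goal is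
a ring identity.\<close>

lemma dvd_combine2:
  "(q::int) dvd A \<Longrightarrow> q dvd B \<Longrightarrow> E = r * A + s * B \<Longrightarrow> q dvd E" by simp

lemma dvd_combine3:
  "(q::int) dvd A \<Longrightarrow> q dvd B \<Longrightarrow> q dvd C \<Longrightarrow> E = r * A + s * B + t * C \<Longrightarrow> q dvd E" by simp

text \<open>Two vectors are parallel modulo \<open>q\<close> if their \<open>2 \<times> 2\<close> minors vanish. If v and w are parallel
to a vector u whose component \<open>ui\<close> is invertible modulo \<open>q\<close>, then \<open>ui\<close> times a minor of v and w is a
combination of minors that involve u, so v and w are parallel.\<close>

lemma parallel_trans_mod_prime:
  fixes q :: int
  assumes "Factorial_Ring.prime q" "\<not> q dvd ui"
    and "q dvd ui * vj - uj * vi" "q dvd ui * vk - uk * vi" "q dvd uj * wk - uk * wj"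
  shows "q dvd vj * wk - vk * wj"
proof -
  have "q dvd ui * (vj * wk - vk * wj)"
    by (rule dvd_combine3[OF assms(3,4,5), of _ wk "- wj" vi]) (simp add: algebra_simps)
  with assms(1,2) show ?thesis by (simp add: prime_dvd_mult_iff)
qed

lemma parallel_multiple_mod_prime:
  fixes q :: int
  assumes "Factorial_Ring.prime q" "\<not> q dvd u1"
    and "q dvd u1 * v2 - u2 * v1" "q dvd u1 * v3 - u3 * v1"
  shows "\<exists>k. q dvd v1 - k * u1 \<and> q dvd v2 - k * u2 \<and> q dvd v3 - k * u3"
proof -
  have "coprime u1 q" using assms(1,2) by (metis coprime_commute prime_imp_coprime)
  then obtain r where "[u1 * r = 1] (mod q)" using cong_solve_coprime_int by blast
  then have r: "q dvd u1 * r - 1" by (simp add: cong_iff_dvd_diff)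
  have "q dvd v1 - (r * v1) * u1"
    by (rule dvd_combine2[OF r r, of _ "- v1" 0]) (simp add: algebra_simps)
  moreover have "q dvd v2 - (r * v1) * u2"
    by (rule dvd_combine2[OF r assms(3), of _ "- v2" r]) (simp add: algebra_simps)
  moreover have "q dvd v3 - (r * v1) * u3"
    by (rule dvd_combine2[OF r assms(4), of _ "- v3" r]) (simp add: algebra_simps)
  ultimately show ?thesis by blast
qed

text \<open>A faithful representation by matrices of determinant 1 over the field with \<open>p\<close> elements. The group
is finite of order prime to \<open>p\<close>, which excludes unipotent matrices. The matrix of x has rows \<open>(a x, b x)\<close> and \<open>(c x, d x)\<close>; the entries are integers of which only the residues modulo
\<open>p\<close> matter, so that \<open>p\<close> remains a variable.\<close>

locale sl2_mod_prime_rep = group G for G (structure) +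
  fixes p :: nat and a b c d :: "'a \<Rightarrow> int"
  assumes p: "Factorial_Ring.prime p"
    and mult: "\<And>x y. \<lbrakk>x \<in> carrier G; y \<in> carrier G\<rbrakk> \<Longrightarrow>
      int p dvd a (x \<otimes> y) - (a x * a y + b x * c y) \<and> int p dvd b (x \<otimes> y) - (a x * b y + b x * d y) \<and>
      int p dvd c (x \<otimes> y) - (c x * a y + d x * c y) \<and> int p dvd d (x \<otimes> y) - (c x * b y + d x * d y)"
    and one: "int p dvd a \<one> - 1" "int p dvd b \<one>" "int p dvd c \<one>" "int p dvd d \<one> - 1"
    and det: "\<And>x. x \<in> carrier G \<Longrightarrow> int p dvd a x * d x - b x * c x - 1"
    and faithful: "\<And>x y. \<lbrakk>x \<in> carrier G; y \<in> carrier G; int p dvd a x - a y; int p dvd b x - b y;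
      int p dvd c x - c y; int p dvd d x - d y\<rbrakk> \<Longrightarrow> x = y"
    and fin: "finite (carrier G)" and p_ndvd: "\<not> p dvd order G"
begin

abbreviation "q \<equiv> int p"

definition "tr x = a x + d x"

definition "scalar x \<longleftrightarrow> q dvd b x \<and> q dvd c x \<and> q dvd a x - d x"

lemma q_prime: "Factorial_Ring.prime q" using p by simp

lemma q_dvd_mult: "q dvd u * v \<longleftrightarrow> q dvd u \<or> q dvd v"
  using q_prime by (rule prime_dvd_mult_iff)

lemma inverse_entries:
  assumes x: "x \<in> carrier G"
  shows "q dvd a (inv x) - d x" "q dvd b (inv x) + b x" "q dvd c (inv x) + c x" "q dvd d (inv x) - a x"
proof -
  let ?A = "a (inv x)" and ?B = "b (inv x)" and ?C = "c (inv x)" and ?D = "d (inv x)"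
  have m: "q dvd a \<one> - (a x * ?A + b x * ?C)" "q dvd b \<one> - (a x * ?B + b x * ?D)"
    "q dvd c \<one> - (c x * ?A + d x * ?C)" "q dvd d \<one> - (c x * ?B + d x * ?D)"
    using mult[of x "inv x"] x by simp_all
  have e: "q dvd a x * ?A + b x * ?C - 1" "q dvd a x * ?B + b x * ?D"
    "q dvd c x * ?A + d x * ?C" "q dvd c x * ?B + d x * ?D - 1"
    by (rule dvd_combine2[OF m(1) one(1), of _ "-1" 1] dvd_combine2[OF m(2) one(2), of _ "-1" 1]
      dvd_combine2[OF m(3) one(3), of _ "-1" 1] dvd_combine2[OF m(4) one(4), of _ "-1" 1], simp)+
  note D = det[OF x]
  show "q dvd ?A - d x"
    by (rule dvd_combine3[OF e(1,3) D, of _ "d x" "- b x" "- ?A"]) (simp add: algebra_simps)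
  show "q dvd ?B + b x"
    by (rule dvd_combine3[OF e(2,4) D, of _ "d x" "- b x" "- ?B"]) (simp add: algebra_simps)
  show "q dvd ?C + c x"
    by (rule dvd_combine3[OF e(1,3) D, of _ "- c x" "a x" "- ?C"]) (simp add: algebra_simps)
  show "q dvd ?D - a x"
    by (rule dvd_combine3[OF e(2,4) D, of _ "- c x" "a x" "- ?D"]) (simp add: algebra_simps)
qed

text \<open>Two matrices commute iff their traceless parts are parallel, where the traceless part of x is
recorded as the vector \<open>(b x, c x, a x - d x)\<close>.\<close>

lemma commute_iff:
  assumes x: "x \<in> carrier G" and y: "y \<in> carrier G"
  shows "x \<otimes> y = y \<otimes> x \<longleftrightarrow> q dvd b x * c y - c x * b y \<and>
    q dvd b x * (a y - d y) - (a x - d x) * b y \<and> q dvd c x * (a y - d y) - (a x - d x) * c y"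
proof -
  note m = mult[OF x y] and m' = mult[OF y x]
  have ma: "q dvd a (x \<otimes> y) - a (y \<otimes> x) - (b x * c y - c x * b y)"
    by (rule dvd_combine2[OF m[THEN conjunct1] m'[THEN conjunct1], of _ 1 "-1"]) (simp add: algebra_simps)
  have mb: "q dvd b (x \<otimes> y) - b (y \<otimes> x) + (b x * (a y - d y) - (a x - d x) * b y)"
    by (rule dvd_combine2[OF m[THEN conjunct2, THEN conjunct1] m'[THEN conjunct2, THEN conjunct1], of _ 1 "-1"])
       (simp add: algebra_simps)
  have mc: "q dvd c (x \<otimes> y) - c (y \<otimes> x) - (c x * (a y - d y) - (a x - d x) * c y)"
    by (rule dvd_combine2[OF m[THEN conjunct2, THEN conjunct2, THEN conjunct1]
          m'[THEN conjunct2, THEN conjunct2, THEN conjunct1], of _ 1 "-1"]) (simp add: algebra_simps)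
  have md: "q dvd d (x \<otimes> y) - d (y \<otimes> x) + (b x * c y - c x * b y)"
    by (rule dvd_combine2[OF m[THEN conjunct2, THEN conjunct2, THEN conjunct2]
          m'[THEN conjunct2, THEN conjunct2, THEN conjunct2], of _ 1 "-1"]) (simp add: algebra_simps)
  show ?thesis
  proof
    assume eq: "x \<otimes> y = y \<otimes> x"
    show "q dvd b x * c y - c x * b y \<and>
      q dvd b x * (a y - d y) - (a x - d x) * b y \<and> q dvd c x * (a y - d y) - (a x - d x) * c y"
      using mb mc md unfolding eq by (simp add: dvd_diff_commute)
  next
    assume *: "q dvd b x * c y - c x * b y \<and>
      q dvd b x * (a y - d y) - (a x - d x) * b y \<and> q dvd c x * (a y - d y) - (a x - d x) * c y"
    show "x \<otimes> y = y \<otimes> x"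
    proof (rule faithful)
      show "q dvd a (x \<otimes> y) - a (y \<otimes> x)" using dvd_add[OF ma, of "b x * c y - c x * b y"] * by simp
      show "q dvd b (x \<otimes> y) - b (y \<otimes> x)"
        using dvd_diff[OF mb, of "b x * (a y - d y) - (a x - d x) * b y"] * by simp
      show "q dvd c (x \<otimes> y) - c (y \<otimes> x)"
        using dvd_add[OF mc, of "c x * (a y - d y) - (a x - d x) * c y"] * by simp
      show "q dvd d (x \<otimes> y) - d (y \<otimes> x)" using dvd_diff[OF md, of "b x * c y - c x * b y"] * by simp
    qed (use x y in auto)
  qed
qed

lemma scalar_in_center:
  assumes "x \<in> carrier G" "scalar x" shows "x \<in> group_center G"
proof -
  have "x \<otimes> y = y \<otimes> x" if "y \<in> carrier G" for y
    using assms(2) by (auto simp: commute_iff[OF assms(1) that] scalar_def)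
  with assms(1) show ?thesis by (simp add: group_center_def)
qed

lemma centralizer_abelian:
  assumes x: "x \<in> carrier G" "\<not> scalar x" and y: "y \<in> elt_centralizer G x" and w: "w \<in> elt_centralizer G x"
  shows "y \<otimes> w = w \<otimes> y"
proof -
  have yG: "y \<in> carrier G" and wG: "w \<in> carrier G" using y w by (auto simp: elt_centralizer_def)
  have xy: "x \<otimes> y = y \<otimes> x" and xw: "x \<otimes> w = w \<otimes> x" using y w by (auto simp: elt_centralizer_def)
  \<comment> \<open>the traceless parts of x, y and w\<close>
  define u where "u = (\<lambda>i::nat. if i = 0 then b x else if i = 1 then c x else a x - d x)"
  define v where "v = (\<lambda>i::nat. if i = 0 then b y else if i = 1 then c y else a y - d y)"
  define z where "z = (\<lambda>i::nat. if i = 0 then b w else if i = 1 then c w else a w - d w)"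
  have uv: "q dvd u i * v j - u j * v i" for i j
    using xy unfolding commute_iff[OF x(1) yG] u_def v_def
    by (auto simp: algebra_simps dvd_diff_commute)
  have uz: "q dvd u i * z j - u j * z i" for i j
    using xw unfolding commute_iff[OF x(1) wG] u_def z_def
    by (auto simp: algebra_simps dvd_diff_commute)
  obtain i where i: "\<not> q dvd u i"
  proof -
    have "\<not> q dvd u 0 \<or> \<not> q dvd u 1 \<or> \<not> q dvd u 2" using x(2) by (simp add: scalar_def u_def)
    then show ?thesis using that by blast
  qed
  have vz: "q dvd v j * z k - v k * z j" for j k
    by (rule parallel_trans_mod_prime[OF q_prime i uv uv uz])
  show ?thesis
    unfolding commute_iff[OF yG wG] using vz[of 0 1] vz[of 0 2] vz[of 1 2]
    by (simp add: v_def z_def algebra_simps)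
qed


lemma tr_mult_commute:
  assumes "x \<in> carrier G" "y \<in> carrier G"
  shows "q dvd tr (x \<otimes> y) - tr (y \<otimes> x)"
proof -
  note m = mult[OF assms(1,2)] and m' = mult[OF assms(2,1)]
  have 1: "q dvd tr (x \<otimes> y) - (a x * a y + b x * c y + c x * b y + d x * d y)"
    by (rule dvd_combine2[OF m[THEN conjunct1] m[THEN conjunct2, THEN conjunct2, THEN conjunct2], of _ 1 1])
       (simp add: tr_def algebra_simps)
  have 2: "q dvd tr (y \<otimes> x) - (a x * a y + b x * c y + c x * b y + d x * d y)"
    by (rule dvd_combine2[OF m'[THEN conjunct1] m'[THEN conjunct2, THEN conjunct2, THEN conjunct2], of _ 1 1])
       (simp add: tr_def algebra_simps)
  from dvd_diff[OF 1 2] show ?thesis by simp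
qed

lemma tr_conj:
  assumes "x \<in> carrier G" "g \<in> carrier G"
  shows "q dvd tr (g \<otimes> x \<otimes> inv g) - tr x"
proof -
  have "x \<otimes> inv g \<otimes> g = x" using assms by (simp add: m_assoc)
  then show ?thesis using tr_mult_commute[of g "x \<otimes> inv g"] assms by (simp add: m_assoc)
qed

text \<open>A matrix x with \<open>(x - e)^2 = 0\<close> and \<open>e = \<plusminus>1\<close> satisfies
\<open>x^n = e^(n+1) (e + n (x - e))\<close>. The exponent \<open>n + 1\<close> in place of \<open>n - 1\<close> is harmless since
\<open>e^2 = 1\<close>, and it makes the formula hold for \<open>n = 0\<close>.\<close>

lemma unipotent_power:
  assumes x: "x \<in> carrier G" and e: "e * e = (1::int)" and t: "q dvd tr x - 2 * e"
  shows "q dvd a (x [^] n) - e ^ Suc n * (e + int n * (a x - e)) \<and> q dvd b (x [^] n) - e ^ Suc n * (int n * b x) \<and>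
    q dvd c (x [^] n) - e ^ Suc n * (int n * c x) \<and> q dvd d (x [^] n) - e ^ Suc n * (e + int n * (d x - e))"
proof (induction n)
  case 0
  then show ?case using one e by simp
next
  case (Suc n)
  let ?y = "x [^] n" and ?E = "e ^ Suc n" and ?n = "int n"
  have y: "?y \<in> carrier G" using x by simp
  note m = mult[OF y x]
  have D: "q dvd a x * d x - b x * c x - 1" by (rule det[OF x])
  have T: "q dvd a x + d x - 2 * e" using t by (simp add: tr_def)
  have EE: "e ^ Suc (Suc n) = e * ?E" by simp
  have ee: "e * (e * z) = z" for z using e by (metis mult.assoc mult_1)
  \<comment> \<open>the diagonal of \<open>(x - e)^2 = 0\<close>, which is Cayley-Hamilton for trace \<open>2 e\<close> and determinant 1\<close>
  have N: "q dvd (a x - e) * (a x - e) + b x * c x" "q dvd (d x - e) * (d x - e) + b x * c x"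
    using e by - (rule dvd_combine2[OF T D, of _ "a x" "-1"] dvd_combine2[OF T D, of _ "d x" "-1"], simp add: algebra_simps)+
  have A: "q dvd a (x [^] Suc n) - (?E * (e + ?n * (a x - e)) * a x + ?E * (?n * b x) * c x)"
    by (rule dvd_combine3[OF m[THEN conjunct1] Suc[THEN conjunct1] Suc[THEN conjunct2, THEN conjunct1],
          of _ 1 "a x" "c x"]) (simp add: algebra_simps)
  have B: "q dvd b (x [^] Suc n) - (?E * (e + ?n * (a x - e)) * b x + ?E * (?n * b x) * d x)"
    by (rule dvd_combine3[OF m[THEN conjunct2, THEN conjunct1] Suc[THEN conjunct1] Suc[THEN conjunct2, THEN conjunct1],
          of _ 1 "b x" "d x"]) (simp add: algebra_simps)
  have C: "q dvd c (x [^] Suc n) - (?E * (?n * c x) * a x + ?E * (e + ?n * (d x - e)) * c x)"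
    by (rule dvd_combine3[OF m[THEN conjunct2, THEN conjunct2, THEN conjunct1]
          Suc[THEN conjunct2, THEN conjunct2, THEN conjunct1] Suc[THEN conjunct2, THEN conjunct2, THEN conjunct2],
          of _ 1 "a x" "c x"]) (simp add: algebra_simps)
  have DD: "q dvd d (x [^] Suc n) - (?E * (?n * c x) * b x + ?E * (e + ?n * (d x - e)) * d x)"
    by (rule dvd_combine3[OF m[THEN conjunct2, THEN conjunct2, THEN conjunct2]
          Suc[THEN conjunct2, THEN conjunct2, THEN conjunct1] Suc[THEN conjunct2, THEN conjunct2, THEN conjunct2],
          of _ 1 "b x" "d x"]) (simp add: algebra_simps)
  show ?case
  proof (intro conjI)
    show "q dvd a (x [^] Suc n) - e ^ Suc (Suc n) * (e + int (Suc n) * (a x - e))"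
      by (rule dvd_combine2[OF A N(1), of _ 1 "?E * ?n"]) (simp only: EE, simp add: algebra_simps ee e)
    show "q dvd b (x [^] Suc n) - e ^ Suc (Suc n) * (int (Suc n) * b x)"
      by (rule dvd_combine2[OF B T, of _ 1 "?E * ?n * b x"]) (simp only: EE, simp add: algebra_simps ee e)
    show "q dvd c (x [^] Suc n) - e ^ Suc (Suc n) * (int (Suc n) * c x)"
      by (rule dvd_combine2[OF C T, of _ 1 "?E * ?n * c x"]) (simp only: EE, simp add: algebra_simps ee e)
    show "q dvd d (x [^] Suc n) - e ^ Suc (Suc n) * (e + int (Suc n) * (d x - e))"
      by (rule dvd_combine2[OF DD N(2), of _ 1 "?E * ?n"]) (simp only: EE, simp add: algebra_simps ee e)
  qed
qed

text \<open>Such an x is \<open>\<plusminus>1\<close> times a unipotent matrix, whose order is a power of p; but p does not divide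
the order of the group. Concretely, the power of x to the group order is 1, and its off-diagonal entries and the
difference of its diagonal entries are those of x times a unit.\<close>

lemma scalar_if_tr_square_eq_4:
  assumes x: "x \<in> carrier G" and t: "q dvd tr x * tr x - 4"
  shows "scalar x"
proof -
  have "q dvd (tr x - 2) * (tr x + 2)" using t by (simp add: algebra_simps)
  then have "q dvd tr x - 2 * 1 \<or> q dvd tr x - 2 * (- 1)" unfolding q_dvd_mult by simp
  then obtain e :: int where e: "e * e = 1" "q dvd tr x - 2 * e"
    by (metis mult_1 mult_minus1 minus_minus)
  let ?n = "order G" let ?E = "e ^ Suc ?n"
  have P: "q dvd a \<one> - ?E * (e + int ?n * (a x - e))" "q dvd b \<one> - ?E * (int ?n * b x)"
    "q dvd c \<one> - ?E * (int ?n * c x)" "q dvd d \<one> - ?E * (e + int ?n * (d x - e))"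
    using unipotent_power[OF x e, of ?n] pow_order_eq_1[OF x] by auto
  have unit: "\<not> q dvd ?E"
  proof
    assume "q dvd ?E"
    then have "q dvd e * e" using q_prime prime_dvd_power by (metis dvd_mult)
    then show False using e q_prime by (simp add: not_prime_unit)
  qed
  have n: "\<not> q dvd int ?n" using p_ndvd by simp
  have "q dvd ?E * (int ?n * b x)" by (rule dvd_combine2[OF P(2) one(2), of _ "-1" 1]) simp
  moreover have "q dvd ?E * (int ?n * c x)" by (rule dvd_combine2[OF P(3) one(3), of _ "-1" 1]) simp
  moreover have "q dvd ?E * (int ?n * (a x - d x))"
  proof -
    have "q dvd a \<one> - d \<one>" by (rule dvd_combine2[OF one(1) one(4), of _ 1 "-1"]) simp
    from dvd_combine3[OF P(1) P(4) this, of _ "-1" 1 1] show ?thesis by (simp add: algebra_simps)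
  qed
  ultimately show ?thesis using unit n by (simp add: q_dvd_mult scalar_def)
qed

text \<open>A matrix y commuting with the non-scalar x has the form \<open>y = s + k x\<close>. If y is conjugate to x,
then it also has the trace t of x and determinant 1, and eliminating \<open>s\<close> gives
\<open>(1 - k^2) (t^2 - 4) \<equiv> 0\<close>. As \<open>t^2\<close> is not 4, this leaves \<open>k = \<plusminus>1\<close>.\<close>

lemma conj_in_centralizer:
  assumes x: "x \<in> carrier G" "\<not> scalar x" and g: "g \<in> carrier G"
    and y: "y = g \<otimes> x \<otimes> inv g" "y \<in> elt_centralizer G x"
  shows "y = x \<or> y = inv x"
proof -
  have yG: "y \<in> carrier G" using y x g by simp
  have xy: "x \<otimes> y = y \<otimes> x" using y(2) by (simp add: elt_centralizer_def)
  define u where "u = (\<lambda>i::nat. if i = 0 then b x else if i = 1 then c x else a x - d x)"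
  define v where "v = (\<lambda>i::nat. if i = 0 then b y else if i = 1 then c y else a y - d y)"
  have uv: "q dvd u i * v j - u j * v i" for i j
    using xy unfolding commute_iff[OF x(1) yG] u_def v_def
    by (auto simp: algebra_simps dvd_diff_commute)
  obtain i where i: "\<not> q dvd u i"
  proof -
    have "\<not> q dvd u 0 \<or> \<not> q dvd u 1 \<or> \<not> q dvd u 2" using x(2) by (simp add: scalar_def u_def)
    then show ?thesis using that by blast
  qed
  have "\<exists>k. q dvd v 0 - k * u 0 \<and> q dvd v 1 - k * u 1 \<and> q dvd v 2 - k * u 2"
  proof -
    have "\<exists>k. q dvd v i - k * u i \<and> q dvd v j - k * u j \<and> q dvd v l - k * u l" for j l
      by (rule parallel_multiple_mod_prime[OF q_prime i uv uv])
    then obtain k where "q dvd v i - k * u i" by blast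
    have all: "q dvd v j - k * u j" for j
    proof -
      have "q dvd u i * (v j - k * u j)"
        by (rule dvd_combine2[OF uv[of i j] \<open>q dvd v i - k * u i\<close>, of _ 1 "u j"]) (simp add: algebra_simps)
      with i show ?thesis by (simp add: q_dvd_mult)
    qed
    then show ?thesis by blast
  qed
  then obtain k where k: "q dvd b y - k * b x" "q dvd c y - k * c x" "q dvd (a y - d y) - k * (a x - d x)"
    by (auto simp: u_def v_def)
  \<comment> \<open>From here on y is \<open>s + k x\<close>: the off-diagonal entries are \<open>k\<close> times those of x by \<open>k\<close>, the
    diagonal ones by the definition of \<open>s\<close> and by \<open>s2\<close>.\<close>
  define s where "s = a y - k * a x"
  have T: "q dvd (a y + d y) - (a x + d x)" using tr_conj[OF x(1) g] y by (simp add: tr_def)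
  have s2: "q dvd d y - k * d x - s" using k(3) by (simp add: s_def algebra_simps dvd_diff_commute)
  have ts: "q dvd 2 * s - (1 - k) * (a x + d x)"
    by (rule dvd_combine2[OF T s2, of _ 1 "-1"]) (simp add: s_def algebra_simps)
  have dets: "q dvd s * s + s * k * (a x + d x) + k * k - 1"
  proof -
    have "q dvd (s + k * a x) * (s + k * d x) - k * k * (b x * c x) - 1"
    proof -
      have 1: "q dvd (s + k * a x) * d y - b y * c y - 1" using det[OF yG] by (simp add: s_def)
      have 2: "q dvd b y * c y - k * k * (b x * c x)"
        by (rule dvd_combine2[OF k(1,2), of _ "c y" "k * b x"]) (simp add: algebra_simps)
      show ?thesis
        by (rule dvd_combine3[OF 1 2 s2, of _ 1 1 "- (s + k * a x)"]) (simp add: algebra_simps)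
    qed
    from this det[OF x(1)] show ?thesis
      by (rule dvd_combine2[of _ _ _ _ 1 "- (k * k)"]) (simp add: algebra_simps)
  qed
  have "q dvd (1 - k) * ((1 + k) * (tr x * tr x - 4))"
    by (rule dvd_combine2[OF dets ts, of _ 4 "- 2 * s - 2 * k * tr x - (1 - k) * tr x"])
       (simp add: tr_def algebra_simps)
  then have "q dvd 1 - k \<or> q dvd 1 + k"
    using scalar_if_tr_square_eq_4[OF x(1)] x(2) by (auto simp: q_dvd_mult)
  \<comment> \<open>For \<open>k = 1\<close> the trace gives \<open>2 s = 0\<close> and the determinant \<open>s (s + t) = 0\<close>. In characteristic 2
    the solution \<open>s = t\<close> is the inverse of x.\<close>
  moreover have "y = x \<or> y = inv x" if k1: "q dvd 1 - k"
  proof -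
    have "q dvd 2 * s" by (rule dvd_combine2[OF ts k1, of _ 1 "a x + d x"]) (simp add: algebra_simps)
    then have "q dvd 2 \<or> q dvd s" by (simp add: q_dvd_mult)
    moreover have "q dvd s * (s + (a x + d x))"
      by (rule dvd_combine2[OF dets k1, of _ 1 "s * (a x + d x) + 1 + k"]) (simp add: algebra_simps)
    ultimately consider "q dvd s" | "q dvd 2" "q dvd s + (a x + d x)" by (auto simp: q_dvd_mult)
    then show ?thesis
    proof cases
      case 1
      have "y = x"
      proof (rule faithful[OF yG x(1)])
        show "q dvd a y - a x"
          by (rule dvd_combine2[OF 1 k1, of _ 1 "- a x"]) (simp add: s_def algebra_simps)
        show "q dvd d y - d x"
          by (rule dvd_combine3[OF 1 k1 s2, of _ 1 "- d x" 1]) (simp add: algebra_simps)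
        show "q dvd b y - b x" by (rule dvd_combine2[OF k(1) k1, of _ 1 "- b x"]) (simp add: algebra_simps)
        show "q dvd c y - c x" by (rule dvd_combine2[OF k(2) k1, of _ 1 "- c x"]) (simp add: algebra_simps)
      qed
      then show ?thesis ..
    next
      case 2
      note I = inverse_entries[OF x(1)]
      have "y = inv x"
      proof (rule faithful[OF yG])
        have "q dvd a y + d x"
          by (rule dvd_combine2[OF 2(2) k1, of _ 1 "- a x"]) (simp add: s_def algebra_simps)
        then show "q dvd a y - a (inv x)"
          by (rule dvd_combine3[OF _ I(1) 2(1), of _ _ 1 "-1" "- d x"]) (simp add: algebra_simps)
        have "q dvd d y + a x"
          by (rule dvd_combine3[OF 2(2) k1 s2, of _ 1 "- d x" 1]) (simp add: algebra_simps)
        then show "q dvd d y - d (inv x)"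
          by (rule dvd_combine3[OF _ I(4) 2(1), of _ _ 1 "-1" "- a x"]) (simp add: algebra_simps)
        have "q dvd b y - b x" by (rule dvd_combine2[OF k(1) k1, of _ 1 "- b x"]) (simp add: algebra_simps)
        then show "q dvd b y - b (inv x)"
          by (rule dvd_combine3[OF _ I(2) 2(1), of _ _ 1 "-1" "b x"]) (simp add: algebra_simps)
        have "q dvd c y - c x" by (rule dvd_combine2[OF k(2) k1, of _ 1 "- c x"]) (simp add: algebra_simps)
        then show "q dvd c y - c (inv x)"
          by (rule dvd_combine3[OF _ I(3) 2(1), of _ _ 1 "-1" "c x"]) (simp add: algebra_simps)
      qed (use x in simp)
      then show ?thesis ..
    qed
  qed
  moreover have "y = inv x" if k1: "q dvd 1 + k" and odd: "\<not> q dvd 2"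
  proof -
    have "q dvd 2 * (s - (a x + d x))"
      by (rule dvd_combine2[OF ts k1, of _ 1 "- (a x + d x)"]) (simp add: algebra_simps)
    then have s: "q dvd s - (a x + d x)" using odd unfolding q_dvd_mult by blast
    note I = inverse_entries[OF x(1)]
    show ?thesis
    proof (rule faithful[OF yG])
      have "q dvd a y - d x"
        by (rule dvd_combine2[OF s k1, of _ 1 "a x"]) (simp add: s_def algebra_simps)
      then show "q dvd a y - a (inv x)"
        by (rule dvd_combine2[OF _ I(1), of _ _ 1 "-1"]) (simp add: algebra_simps)
      have "q dvd d y - a x"
        by (rule dvd_combine3[OF s k1 s2, of _ 1 "d x" 1]) (simp add: algebra_simps)
      then show "q dvd d y - d (inv x)"
        by (rule dvd_combine2[OF _ I(4), of _ _ 1 "-1"]) (simp add: algebra_simps)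
      show "q dvd b y - b (inv x)"
        by (rule dvd_combine3[OF k(1) k1 I(2), of _ 1 "b x" "-1"]) (simp add: algebra_simps)
      show "q dvd c y - c (inv x)"
        by (rule dvd_combine3[OF k(2) k1 I(3), of _ 1 "c x" "-1"]) (simp add: algebra_simps)
    qed (use x in simp)
  qed
  moreover have "q dvd 1 - k" if "q dvd 2" "q dvd 1 + k"
    by (rule dvd_combine2[OF that, of _ 1 "-1"]) simp
  ultimately show ?thesis by blast
qed

text \<open>By Cayley-Hamilton \<open>x^2 = t x - 1\<close>, so \<open>x^2 = 1\<close> means \<open>t x = 2\<close>; as p is odd, t is invertible
and x is scalar.\<close>

lemma involution_in_center:
  assumes x: "x \<in> carrier G" "x \<otimes> x = \<one>" and odd: "\<not> q dvd 2"
  shows "x \<in> group_center G"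
proof (rule scalar_in_center[OF x(1)])
  note m = mult[OF x(1) x(1), unfolded x(2)] and D = det[OF x(1)]
  have A: "q dvd a x * a x + b x * c x - 1"
    by (rule dvd_combine2[OF m[THEN conjunct1] one(1), of _ "-1" 1]) (simp add: algebra_simps)
  have B: "q dvd b x * tr x"
    by (rule dvd_combine2[OF m[THEN conjunct2, THEN conjunct1] one(2), of _ "-1" 1]) (simp add: tr_def algebra_simps)
  have C: "q dvd c x * tr x"
    by (rule dvd_combine2[OF m[THEN conjunct2, THEN conjunct2, THEN conjunct1] one(3), of _ "-1" 1])
       (simp add: tr_def algebra_simps)
  have E: "q dvd c x * b x + d x * d x - 1"
    by (rule dvd_combine2[OF m[THEN conjunct2, THEN conjunct2, THEN conjunct2] one(4), of _ "-1" 1])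
       (simp add: tr_def algebra_simps)
  have t: "\<not> q dvd tr x"
  proof
    assume t: "q dvd tr x"
    have "q dvd 2" by (rule dvd_combine3[OF A D t, of _ "-1" "-1" "a x"]) (simp add: tr_def algebra_simps)
    with odd show False by contradiction
  qed
  have "q dvd tr x * (a x - d x)"
    by (rule dvd_combine2[OF A E, of _ 1 "-1"]) (simp add: tr_def algebra_simps)
  with B C t show "scalar x" by (simp add: scalar_def q_dvd_mult)
qed

lemma scalar_square:
  assumes x: "x \<in> carrier G" "scalar x"
  shows "x \<otimes> x = \<one>"
proof -
  note m = mult[OF x(1) x(1)] and D = det[OF x(1)]
  have S: "q dvd b x" "q dvd c x" "q dvd a x - d x" using x(2) by (auto simp: scalar_def)
  have ad: "q dvd a x * d x - 1"
    by (rule dvd_combine2[OF D S(1), of _ 1 "c x"]) (simp add: algebra_simps)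
  show ?thesis
  proof (rule faithful)
    have 1: "q dvd a (x \<otimes> x) - a x * a x"
      by (rule dvd_combine2[OF m[THEN conjunct1] S(1), of _ 1 "c x"]) (simp add: algebra_simps)
    have 2: "q dvd a x * a x - a \<one>"
      by (rule dvd_combine3[OF ad S(3) one(1), of _ 1 "a x" "-1"]) (simp add: algebra_simps)
    show "q dvd a (x \<otimes> x) - a \<one>" using dvd_add[OF 1 2] by simp
    show "q dvd b (x \<otimes> x) - b \<one>"
      by (rule dvd_combine3[OF m[THEN conjunct2, THEN conjunct1] S(1) one(2), of _ 1 "a x + d x" "-1"])
         (simp add: algebra_simps)
    show "q dvd c (x \<otimes> x) - c \<one>"
      by (rule dvd_combine3[OF m[THEN conjunct2, THEN conjunct2, THEN conjunct1] S(2) one(3), of _ 1 "a x + d x" "-1"])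
         (simp add: algebra_simps)
    have 3: "q dvd d (x \<otimes> x) - d x * d x"
      by (rule dvd_combine2[OF m[THEN conjunct2, THEN conjunct2, THEN conjunct2] S(1), of _ 1 "c x"])
         (simp add: algebra_simps)
    have 4: "q dvd d x * d x - d \<one>"
      by (rule dvd_combine3[OF ad S(3) one(4), of _ 1 "- d x" "-1"]) (simp add: algebra_simps)
    show "q dvd d (x \<otimes> x) - d \<one>" using dvd_add[OF 3 4] by simp
  qed (use x in auto)
qed

lemma square_entries:
  assumes x: "x \<in> carrier G"
  shows "q dvd a (x \<otimes> x) - (tr x * a x - 1)" "q dvd b (x \<otimes> x) - tr x * b x"
    "q dvd c (x \<otimes> x) - tr x * c x" "q dvd d (x \<otimes> x) - (tr x * d x - 1)" "q dvd tr (x \<otimes> x) - (tr x * tr x - 2)"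
proof -
  note m = mult[OF x x] and D = det[OF x]
  show A: "q dvd a (x \<otimes> x) - (tr x * a x - 1)"
    by (rule dvd_combine2[OF m[THEN conjunct1] D, of _ 1 "-1"]) (simp add: tr_def algebra_simps)
  show "q dvd b (x \<otimes> x) - tr x * b x"
    using m[THEN conjunct2, THEN conjunct1] by (simp add: tr_def algebra_simps)
  show "q dvd c (x \<otimes> x) - tr x * c x"
    using m[THEN conjunct2, THEN conjunct2, THEN conjunct1] by (simp add: tr_def algebra_simps)
  show E: "q dvd d (x \<otimes> x) - (tr x * d x - 1)"
    by (rule dvd_combine2[OF m[THEN conjunct2, THEN conjunct2, THEN conjunct2] D, of _ 1 "-1"])
       (simp add: tr_def algebra_simps)
  show "q dvd tr (x \<otimes> x) - (tr x * tr x - 2)"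
    by (rule dvd_combine2[OF A E, of _ 1 1]) (simp add: tr_def algebra_simps)
qed

text \<open>Cayley-Hamilton expresses both sides of \<open>x^4 = inv x\<close> through x. For non-scalar x the
coefficients of x agree, which is \<open>t^3 - 2 t + 1 = (t - 1) (t^2 + t - 1) \<equiv> 0\<close>. The factor \<open>t - 1\<close> is
excluded by comparing traces: \<open>t = 1\<close> would give trace -1 for \<open>x^2\<close> and \<open>x^4\<close>, while \<open>inv x\<close> has
trace 1, and p is odd.\<close>

lemma order_5_trace:
  assumes x: "x \<in> carrier G" "ord x = 5" and odd: "\<not> q dvd 2"
  shows "q dvd tr x * tr x + tr x - 1"
proof -
  have nsc: "\<not> scalar x"
  proof
    assume "scalar x"
    then have "x [^] (2::nat) = \<one>" using scalar_square[OF x(1)] x(1) by (simp add: numeral_2_eq_2)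
    then have "5 dvd (2::nat)" using pow_eq_id[OF x(1)] x(2) by metis
    then show False by simp
  qed
  let ?y = "x \<otimes> x" let ?t = "tr x"
  have y: "?y \<in> carrier G" using x by simp
  have "?y \<otimes> ?y \<otimes> x = x [^] (5::nat)" using x(1) by (simp add: numeral_eq_Suc m_assoc)
  also have "\<dots> = \<one>" using pow_ord_eq_1[OF x(1)] x(2) by simp
  finally have inv: "?y \<otimes> ?y = inv x" using x y by (metis inv_equality inv_inv m_closed)
  note Y = square_entries[OF x(1)] and Z = square_entries[OF y, unfolded inv] and I = inverse_entries[OF x(1)]
  let ?f = "?t * ?t * ?t - 2 * ?t + 1"
  have b: "q dvd b x * ?f"
  proof -
    have 1: "q dvd tr ?y * b ?y - (?t * ?t - 2) * (?t * b x)"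
      by (rule dvd_combine2[OF Y(5) Y(2), of _ "b ?y" "?t * ?t - 2"]) (simp add: algebra_simps)
    show ?thesis
      by (rule dvd_combine3[OF 1 Z(2) I(2), of _ "-1" "-1" 1]) (simp add: algebra_simps)
  qed
  have c: "q dvd c x * ?f"
  proof -
    have 1: "q dvd tr ?y * c ?y - (?t * ?t - 2) * (?t * c x)"
      by (rule dvd_combine2[OF Y(5) Y(3), of _ "c ?y" "?t * ?t - 2"]) (simp add: algebra_simps)
    show ?thesis
      by (rule dvd_combine3[OF 1 Z(3) I(3), of _ "-1" "-1" 1]) (simp add: algebra_simps)
  qed
  have ad: "q dvd (a x - d x) * ?f"
  proof -
    have 0: "q dvd (a ?y - d ?y) - ?t * (a x - d x)"
      by (rule dvd_combine2[OF Y(1) Y(4), of _ 1 "-1"]) (simp add: algebra_simps)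
    have 1: "q dvd tr ?y * (a ?y - d ?y) - (?t * ?t - 2) * (?t * (a x - d x))"
      by (rule dvd_combine2[OF Y(5) 0, of _ "a ?y - d ?y" "?t * ?t - 2"]) (simp add: algebra_simps)
    have 2: "q dvd (a (inv x) - d (inv x)) - tr ?y * (a ?y - d ?y)"
      by (rule dvd_combine2[OF Z(1) Z(4), of _ 1 "-1"]) (simp add: algebra_simps)
    have 3: "q dvd (a (inv x) - d (inv x)) + (a x - d x)"
      by (rule dvd_combine2[OF I(1) I(4), of _ 1 "-1"]) (simp add: algebra_simps)
    show ?thesis
      by (rule dvd_combine3[OF 1 2 3, of _ "-1" "-1" 1]) (simp add: algebra_simps)
  qed
  have "q dvd ?f" using b c ad nsc unfolding q_dvd_mult scalar_def by blast
  then have "q dvd (?t - 1) * (?t * ?t + ?t - 1)" by (simp add: algebra_simps)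
  moreover have "\<not> q dvd ?t - 1"
  proof
    assume t: "q dvd ?t - 1"
    have 1: "q dvd tr (inv x) - ?t"
      by (rule dvd_combine2[OF I(1) I(4), of _ 1 1]) (simp add: tr_def algebra_simps)
    have y1: "q dvd tr ?y + 1"
      by (rule dvd_combine2[OF Y(5) t, of _ 1 "?t + 1"]) (simp add: algebra_simps)
    have z1: "q dvd tr (inv x) + 1"
      by (rule dvd_combine2[OF Z(5) y1, of _ 1 "tr ?y - 1"]) (simp add: algebra_simps)
    have "q dvd 2"
      by (rule dvd_combine3[OF z1 1 t, of _ 1 "-1" "-1"]) simp
    with odd show False by contradiction
  qed
  ultimately show ?thesis by (simp add: q_dvd_mult)
qed

end

text \<open>By quadratic reciprocity p is a square modulo 5, that is, \<open>\<plusminus>1\<close>; and p is odd.\<close>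

lemma five_square_mod_prime:
  fixes p :: nat
  assumes p: "Factorial_Ring.prime p" "2 < p" "p \<noteq> 5" and sq: "[y ^ 2 = 5] (mod int p)"
  shows "[int p = 1] (mod 10) \<or> [int p = - 1] (mod 10)"
proof -
  have p5: "\<not> int p dvd 5"
  proof
    assume "int p dvd 5"
    then have "p dvd 5" by (metis int_dvd_int_iff of_nat_numeral)
    moreover have "Factorial_Ring.prime (5::nat)" by simp
    ultimately show False using p primes_dvd_imp_eq by blast
  qed
  have "QuadRes (int p) 5" using sq by (auto simp: QuadRes_def)
  then have "Legendre 5 (int p) = 1" using p5 by (simp add: Legendre_def cong_0_iff)
  moreover have "Legendre (int p) 5 * Legendre 5 (int p) = (-1) ^ nat ((int p - 1) div 2 * ((5 - 1) div 2))"
    by (rule Quadratic_Reciprocity_int) (use p in auto)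
  moreover have "(-1::int) ^ nat ((int p - 1) div 2 * ((5 - 1) div 2)) = 1"
  proof -
    have "nat ((int p - 1) div 2 * ((5 - 1) div 2)) = 2 * nat ((int p - 1) div 2)"
      using p by (simp add: nat_mult_distrib)
    then show ?thesis by simp
  qed
  ultimately have "Legendre (int p) 5 = 1" by simp
  then have "QuadRes 5 (int p)" by (auto simp: Legendre_def split: if_splits)
  then obtain w where "[w ^ 2 = int p] (mod 5)" by (auto simp: QuadRes_def)
  then have "int p mod 5 = (w mod 5) ^ 2 mod 5" by (simp add: cong_def power_mod)
  then obtain r where r: "int p mod 5 = r ^ 2 mod 5" "r = w mod 5" by blast
  have "\<not> 5 dvd int p"
  proof
    assume "5 dvd int p"
    then have "5 dvd p" by (metis int_dvd_int_iff of_nat_numeral)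
    then show False using p primes_dvd_imp_eq[of 5 p] by simp
  qed
  then have p0: "int p mod 5 \<noteq> 0" by (simp add: dvd_eq_mod_eq_0)
  have "r = 0 \<or> r = 1 \<or> r = 2 \<or> r = 3 \<or> r = 4" unfolding r(2) by presburger
  then have "int p mod 5 = 1 \<or> int p mod 5 = 4"
    using p0 unfolding r(1) by (elim disjE) simp_all
  then have "5 dvd int p - 1 \<or> 5 dvd int p + 1"
    using mod_eq_dvd_iff[of "int p" 5 1] mod_eq_dvd_iff[of "int p" 5 "- 1"] by simp
  moreover have "odd (int p)" using p primes_dvd_imp_eq[of 2 p] by auto
  then have "2 dvd int p - 1" "2 dvd int p + 1" by simp_all
  moreover have "coprime 5 (2::int)" by simp
  ultimately have "5 * 2 dvd int p - 1 \<or> 5 * 2 dvd int p + 1"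
    using divides_mult by blast
  then show ?thesis by (simp add: cong_iff_dvd_diff)
qed

text \<open>The prime p is neither 2 nor 5 because 60 divides the order of the group. Hence involutions are central, which
doubles the divisor 60, and elements of order 5 exist, whose traces make \<open>(2 t + 1)^2 \<equiv> 5\<close>.\<close>

theorem (in sl2_mod_prime_rep) perfect_order:
  assumes perf: "perfect_group G" and nontriv: "carrier G \<noteq> {\<one>}"
  shows "120 dvd order G \<and> ([int p = 1] (mod 10) \<or> [int p = - 1] (mod 10))"
proof -
  have noncentral: "\<not> scalar x" if "x \<in> carrier G" "x \<notin> group_center G" for x
    using scalar_in_center that by blast
  have order: "order G = 60 * card (group_center G)"
  proof (rule perfect_group_abelian_centralizers_order[OF perf fin nontriv])
    fix x y w assume x: "x \<in> carrier G" "x \<notin> group_center G"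
      and "y \<in> elt_centralizer G x" "w \<in> elt_centralizer G x"
    then show "y \<otimes> w = w \<otimes> y" using centralizer_abelian[OF x(1) noncentral[OF x]] by blast
  next
    fix x g assume x: "x \<in> carrier G" "x \<notin> group_center G" and g: "g \<in> carrier G"
      and "g \<otimes> x \<otimes> inv g \<in> elt_centralizer G x"
    then show "g \<otimes> x \<otimes> inv g = x \<or> g \<otimes> x \<otimes> inv g = inv x"
      using conj_in_centralizer[OF x(1) noncentral[OF x] g refl] by blast
  qed
  have "p \<noteq> 2" "p \<noteq> 5" using p_ndvd order by auto
  have p2: "2 < p" using \<open>p \<noteq> 2\<close> prime_ge_2_nat[OF p] by linarith
  have odd: "\<not> q dvd 2"
  proof
    assume "q dvd 2"
    then have "p dvd 2" by (metis int_dvd_int_iff of_nat_numeral)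
    with p2 show False by (simp add: nat_dvd_not_less)
  qed
  obtain z where z: "z \<in> carrier G" "ord z = 2"
    using cauchy[OF fin two_is_prime_nat] order by auto
  then have zz: "z \<otimes> z = \<one>" using pow_ord_eq_1[OF z(1)] by (simp add: numeral_2_eq_2)
  have zZ: "z \<in> group_center G" by (rule involution_in_center[OF z(1) zz odd])
  have "card (generate G {z}) dvd card (group_center G)"
    by (rule card_subgroup_dvd[OF generate_is_subgroup subgroup_group_center])
       (use z(1) zZ generate_subgroup_incl[OF _ subgroup_group_center, of "{z}"] in auto)
  then have "2 dvd card (group_center G)" using generate_pow_card[OF z(1)] z(2) by simp
  then have 120: "120 dvd order G" unfolding order using mult_dvd_mono[of 60 60 2] by simp
  have "Factorial_Ring.prime (5::nat)" by simp
  from cauchy[OF fin this] obtain x where x: "x \<in> carrier G" "ord x = 5" using order by auto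
  have t: "q dvd tr x * tr x + tr x - 1" by (rule order_5_trace[OF x odd])
  have "q dvd (2 * tr x + 1) ^ 2 - 5"
    by (rule dvd_combine2[OF t t, of _ 4 0]) (simp add: power2_eq_square algebra_simps)
  then have "[(2 * tr x + 1) ^ 2 = 5] (mod q)" by (simp add: cong_iff_dvd_diff)
  from five_square_mod_prime[OF p p2 \<open>p \<noteq> 5\<close> this] 120 show ?thesis by blast
qed

section \<open>Central elements of prime order\<close>

text \<open>The centralizer of a noncentral element lies strictly above the nontrivial centre, so its order is
\<open>p ^ 2\<close> and it is the whole group.\<close>

lemma (in group) commute_if_order_dvd_prime_square:
  assumes fin: "finite (carrier G)" and p: "Factorial_Ring.prime p" and dvd: "order G dvd p ^ 2"
    and center: "group_center G \<noteq> {\<one>}" and x: "x \<in> carrier G" and y: "y \<in> carrier G"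
  shows "x \<otimes> y = y \<otimes> x"
proof (rule ccontr)
  assume nc: "x \<otimes> y \<noteq> y \<otimes> x"
  let ?Z = "group_center G" and ?C = "elt_centralizer G y"
  have Z: "subgroup ?Z G" by (rule subgroup_group_center)
  have C: "subgroup ?C G" by (rule subgroup_elt_centralizer[OF y])
  have pos: "0 < p" by (rule prime_gt_0_nat[OF p])
  have "card ?Z \<noteq> 1" using center subgroup.one_closed[OF Z] by (auto simp: card_1_singleton_iff)
  have dvdG: "card H dvd p ^ 2" if "subgroup H G" for H
    using card_subgroup_dvd[OF that subgroup_self subgroup.subset[OF that]] dvd
    by (auto simp: order_def intro: dvd_trans)
  obtain i where i: "i \<le> 2" "card ?Z = p ^ i" using dvdG[OF Z] divides_primepow_nat[OF p] by blast
  with \<open>card ?Z \<noteq> 1\<close> have "1 \<le> i" by (cases i) auto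
  then have "p ^ 1 \<le> card ?Z" unfolding i(2) using pos by (intro power_increasing) auto
  moreover have "?Z \<subset> ?C"
  proof
    show "?Z \<subseteq> ?C" using y by (auto simp: group_center_def elt_centralizer_def)
    have "y \<notin> ?Z"
    proof
      assume "y \<in> ?Z"
      then have "y \<otimes> x = x \<otimes> y" using x by (simp add: group_center_def)
      with nc show False by simp
    qed
    moreover have "y \<in> ?C" using y by (simp add: elt_centralizer_def)
    ultimately show "?Z \<noteq> ?C" by blast
  qed
  moreover have finC: "finite ?C" using subgroup.subset[OF C] fin by (rule finite_subset)
  ultimately have less: "p ^ 1 < card ?C" using psubset_card_mono by (metis le_less_trans)
  obtain j where j: "j \<le> 2" "card ?C = p ^ j" using dvdG[OF C] divides_primepow_nat[OF p] by blast
  have "1 < j" using less unfolding j(2) using prime_gt_1_nat[OF p] power_less_imp_less_exp by blast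
  with j have "card ?C = p ^ 2" by (metis One_nat_def Suc_leI le_antisym one_add_one plus_1_eq_Suc)
  moreover have "card (carrier G) \<le> p ^ 2" using dvd pos by (simp add: order_def dvd_imp_le)
  ultimately have "?C = carrier G" using card_subset_eq[OF fin subgroup.subset[OF C]]
      card_mono[OF fin subgroup.subset[OF C]] by linarith
  then have "x \<in> ?C" using x by simp
  then show False using nc by (simp add: elt_centralizer_def)
qed

lemma (in group) exists_prime_order_in_subgroup:
  assumes P: "subgroup P G" and fin: "finite P" and p: "Factorial_Ring.prime p" and dvd: "p dvd card P"
  shows "\<exists>x\<in>P. x \<noteq> \<one> \<and> x [^] p = \<one>"
proof -
  interpret P: group "G\<lparr>carrier := P\<rparr>" by (rule subgroup_imp_group[OF P])
  obtain x where x: "x \<in> P" "P.ord x = p"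
    using P.cauchy[OF _ p] fin dvd by (auto simp: order_def)
  have "x [^] p = \<one>" using P.pow_ord_eq_1[of x] x nat_pow_consistent[of x p P] by simp
  moreover have "x \<noteq> \<one>" using x P.ord_id p by auto
  ultimately show ?thesis using x by blast
qed

text \<open>Otherwise a Sylow p-subgroup has order p or \<open>p ^ 2\<close> and contains a central element of order p. Hence
it is abelian, and transfer into it is contradictory.\<close>

lemma perfect_group_prime_cube_dvd_if_central:
  fixes G (structure)
  assumes perf: "perfect_group G" and fin: "finite (carrier G)" and p: "Factorial_Ring.prime p"
    and dvd: "p dvd order G"
    and central: "\<And>x. x \<in> carrier G \<Longrightarrow> x [^] p = \<one> \<Longrightarrow> x \<in> group_center G"
  shows "p ^ 3 dvd order G"
proof (rule ccontr)
  interpret group G using perf by (simp add: perfect_group_def)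
  assume n3: "\<not> p ^ 3 dvd order G"
  have pos: "order G \<noteq> 0" using fin order_gt_0_iff_finite by simp
  obtain m where m: "order G = p ^ multiplicity p (order G) * m" "\<not> p dvd m"
    using multiplicity_decompose'[of "order G" p] pos p not_prime_unit by metis
  define e where "e = multiplicity p (order G)"
  have em: "order G = p ^ e * m" using m(1) by (simp add: e_def)
  have "e < 3"
  proof (rule ccontr)
    assume "\<not> e < 3"
    then have "p ^ 3 dvd p ^ e" by (intro le_imp_power_dvd) simp
    with n3 show False unfolding em by simp
  qed
  have "e \<noteq> 0" using dvd m(2) em by (cases e) auto
  obtain P where P: "subgroup P G" "card P = p ^ e" using sylow_thm[OF p is_group em fin] by blast
  have finP: "finite P" using subgroup.subset[OF P(1)] fin by (rule finite_subset)
  have "p dvd card P" using P(2) \<open>e \<noteq> 0\<close> by simp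
  then obtain x where x: "x \<in> P" "x \<noteq> \<one>" "x [^] p = \<one>"
    using exists_prime_order_in_subgroup[OF P(1) finP p] by blast
  have xG: "x \<in> carrier G" using subgroup.mem_carrier[OF P(1) x(1)] .
  have xZ: "x \<otimes> g = g \<otimes> x" if "g \<in> carrier G" for g
    using central[OF xG x(3)] that by (simp add: group_center_def)
  have comm: "y \<otimes> w = w \<otimes> y" if "y \<in> P" "w \<in> P" for y w
  proof -
    interpret P: group "G\<lparr>carrier := P\<rparr>" by (rule subgroup_imp_group[OF P(1)])
    have "x \<in> group_center (G\<lparr>carrier := P\<rparr>)"
      using x(1) xZ subgroup.mem_carrier[OF P(1)] by (simp add: group_center_def)
    then have "group_center (G\<lparr>carrier := P\<rparr>) \<noteq> {\<one>\<^bsub>G\<lparr>carrier := P\<rparr>\<^esub>}" using x(2) by auto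
    moreover have "order (G\<lparr>carrier := P\<rparr>) dvd p ^ 2"
      using P(2) \<open>e < 3\<close> by (simp add: order_def le_imp_power_dvd)
    ultimately show ?thesis
      using P.commute_if_order_dvd_prime_square[OF _ p, of y w] finP that by simp
  qed
  have "card (rcosets P) * p ^ e = m * p ^ e" using lagrange[OF P(1)] P(2) em by (simp add: mult.commute)
  then have "card (rcosets P) = m" using prime_gt_0_nat[OF p] by simp
  then have "\<not> p dvd card (rcosets P)" using m(2) by simp
  from perfect_group_no_central_prime_order[OF perf fin P(1) comm p this x(1) xZ x(3)] x(2)
  show False by blast
qed

lemma (in group) cancel_left:
  assumes "g \<in> carrier G" "x \<in> carrier G"
  shows "g \<otimes> (inv g \<otimes> x) = x" "inv g \<otimes> (g \<otimes> x) = x"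
  using assms by (simp_all flip: m_assoc)

section \<open>Conjugation on a normal elementary abelian subgroup of rank two\<close>

text \<open>A normal subgroup \<open>V\<close> with the additive structure of a plane over the field with \<open>p\<close> elements:
every element has coordinates with respect to \<open>e1\<close>, \<open>e2\<close>, and these are integers determined modulo \<open>p\<close>.\<close>

locale normal_plane = group G for G (structure) +
  fixes p :: nat and V :: "'a set" and e1 e2 :: 'a
  assumes V: "V \<lhd> G" and e: "e1 \<in> V" "e2 \<in> V"
    and comm: "\<And>v w. v \<in> V \<Longrightarrow> w \<in> V \<Longrightarrow> v \<otimes> w = w \<otimes> v"
    and span: "\<And>v. v \<in> V \<Longrightarrow> \<exists>(i::int) (j::int). v = e1 [^] i \<otimes> e2 [^] j"
    and indep: "\<And>(i::int) (j::int). e1 [^] i \<otimes> e2 [^] j = \<one> \<longleftrightarrow> int p dvd i \<and> int p dvd j"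
begin

definition E :: "int \<Rightarrow> int \<Rightarrow> 'a" where "E i j = e1 [^] i \<otimes> e2 [^] j"

definition "fixer = {g \<in> carrier G. \<forall>v\<in>V. g \<otimes> v = v \<otimes> g}"

lemma V_carrier: "v \<in> V \<Longrightarrow> v \<in> carrier G"
  using V normal_imp_subgroup subgroup.mem_carrier by metis

lemma e_carrier [simp]: "e1 \<in> carrier G" "e2 \<in> carrier G"
  using e V_carrier by auto

lemma E_carrier [simp]: "E i j \<in> carrier G" by (simp add: E_def)

lemma e_powers_commute: "e1 [^] (i::int) \<otimes> e2 [^] (j::int) = e2 [^] j \<otimes> e1 [^] i"
  using comm subgroup_int_pow_closed[OF normal_imp_subgroup[OF V]] e by simp

lemma E_mult: "E i j \<otimes> E k l = E (i + k) (j + l)"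
proof -
  have "E i j \<otimes> E k l = e1 [^] i \<otimes> (e2 [^] j \<otimes> e1 [^] k) \<otimes> e2 [^] l" by (simp add: E_def m_assoc)
  also have "\<dots> = e1 [^] i \<otimes> (e1 [^] k \<otimes> e2 [^] j) \<otimes> e2 [^] l" by (simp add: e_powers_commute)
  also have "\<dots> = E (i + k) (j + l)" by (simp add: E_def m_assoc int_pow_mult)
  finally show ?thesis .
qed

lemma E_inv: "inv (E i j) = E (- i) (- j)"
proof (rule inv_equality)
  show "E (- i) (- j) \<otimes> E i j = \<one>" unfolding E_mult by (simp add: E_def)
qed auto

lemma E_eq_iff: "E i j = E k l \<longleftrightarrow> int p dvd i - k \<and> int p dvd j - l"
proof -
  have "E i j = E k l \<longleftrightarrow> E i j \<otimes> inv (E k l) = \<one>"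
    by (metis E_carrier inv_closed inv_equality inv_inv r_inv)
  also have "E i j \<otimes> inv (E k l) = E (i - k) (j - l)" unfolding E_inv E_mult by simp
  also have "E (i - k) (j - l) = \<one> \<longleftrightarrow> int p dvd i - k \<and> int p dvd j - l" unfolding E_def by (rule indep)
  finally show ?thesis .
qed

lemma E_int_pow: "E i j [^] (k::int) = E (i * k) (j * k)"
  unfolding E_def by (simp add: int_pow_mult_distrib e_powers_commute int_pow_pow)

lemma conj_in_V: "g \<in> carrier G \<Longrightarrow> v \<in> V \<Longrightarrow> g \<otimes> v \<otimes> inv g \<in> V"
  using V normal_inv_iff by blast

definition coords :: "'a \<Rightarrow> int \<times> int" where
  "coords v = (SOME z. v = E (fst z) (snd z))"

text \<open>The matrix of the conjugation by \<open>g\<close>; its columns are the coordinates of the images of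
\<open>e1\<close> and \<open>e2\<close>.\<close>

definition "ca g = fst (coords (g \<otimes> e1 \<otimes> inv g))"
definition "cb g = fst (coords (g \<otimes> e2 \<otimes> inv g))"
definition "cc g = snd (coords (g \<otimes> e1 \<otimes> inv g))"
definition "cd g = snd (coords (g \<otimes> e2 \<otimes> inv g))"

lemma E_coords:
  assumes "v \<in> V"
  shows "v = E (fst (coords v)) (snd (coords v))"
proof -
  obtain i j where "v = E i j" using span[OF assms] unfolding E_def by blast
  then have "\<exists>z. v = E (fst z) (snd z)" by (intro exI[of _ "(i, j)"]) simp
  then show ?thesis unfolding coords_def by (rule someI_ex)
qed

lemma conj_e:
  assumes g: "g \<in> carrier G"
  shows "g \<otimes> e1 \<otimes> inv g = E (ca g) (cc g)" "g \<otimes> e2 \<otimes> inv g = E (cb g) (cd g)"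
  unfolding ca_def cb_def cc_def cd_def using E_coords conj_in_V[OF g] e by blast+

lemma conj_mult:
  assumes "g \<in> carrier G" "x \<in> carrier G" "y \<in> carrier G"
  shows "g \<otimes> (x \<otimes> y) \<otimes> inv g = (g \<otimes> x \<otimes> inv g) \<otimes> (g \<otimes> y \<otimes> inv g)"
  using assms by (simp add: m_assoc cancel_left)

lemma conj_E:
  assumes g: "g \<in> carrier G"
  shows "g \<otimes> E i j \<otimes> inv g = E (ca g * i + cb g * j) (cc g * i + cd g * j)"
proof -
  have hom: "group_hom G G (\<lambda>x. g \<otimes> x \<otimes> inv g)"
    using g conj_mult by unfold_locales (auto simp: hom_def)
  have "g \<otimes> E i j \<otimes> inv g = (g \<otimes> e1 [^] i \<otimes> inv g) \<otimes> (g \<otimes> e2 [^] j \<otimes> inv g)"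
    unfolding E_def using g by (simp add: conj_mult)
  also have "\<dots> = E (ca g) (cc g) [^] i \<otimes> E (cb g) (cd g) [^] j"
    using group_hom.hom_int_pow[OF hom] conj_e[OF g] by simp
  also have "\<dots> = E (ca g * i + cb g * j) (cc g * i + cd g * j)" by (simp add: E_int_pow E_mult)
  finally show ?thesis .
qed

lemma coeffs_mult:
  assumes g: "g \<in> carrier G" and h: "h \<in> carrier G"
  shows "int p dvd ca (g \<otimes> h) - (ca g * ca h + cb g * cc h) \<and> int p dvd cb (g \<otimes> h) - (ca g * cb h + cb g * cd h) \<and>
    int p dvd cc (g \<otimes> h) - (cc g * ca h + cd g * cc h) \<and> int p dvd cd (g \<otimes> h) - (cc g * cb h + cd g * cd h)"
proof -
  have gh: "(g \<otimes> h) \<otimes> v \<otimes> inv (g \<otimes> h) = g \<otimes> (h \<otimes> v \<otimes> inv h) \<otimes> inv g" if "v \<in> carrier G" for v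
    using g h that by (simp add: inv_mult_group m_assoc)
  have "E (ca (g \<otimes> h)) (cc (g \<otimes> h)) = E (ca g * ca h + cb g * cc h) (cc g * ca h + cd g * cc h)"
    using gh[of e1] conj_e[of "g \<otimes> h"] conj_e[OF h] conj_E[OF g] g h by simp
  moreover have "E (cb (g \<otimes> h)) (cd (g \<otimes> h)) = E (ca g * cb h + cb g * cd h) (cc g * cb h + cd g * cd h)"
    using gh[of e2] conj_e[of "g \<otimes> h"] conj_e[OF h] conj_E[OF g] g h by simp
  ultimately show ?thesis unfolding E_eq_iff by blast
qed

text \<open>The matrices modulo \<open>p\<close> separate exactly the cosets of the kernel \<open>fixer\<close> of the action on \<open>V\<close>.
This makes the entries well defined on the quotient and the resulting representation faithful.\<close>

lemma same_coeffs_iff: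
  assumes g: "g \<in> carrier G" and h: "h \<in> carrier G"
  shows "g \<otimes> inv h \<in> fixer \<longleftrightarrow> int p dvd ca g - ca h \<and> int p dvd cb g - cb h \<and>
    int p dvd cc g - cc h \<and> int p dvd cd g - cd h"
proof -
  have "g \<otimes> inv h \<in> fixer \<longleftrightarrow> (\<forall>v\<in>V. (g \<otimes> inv h) \<otimes> v \<otimes> inv (g \<otimes> inv h) = v)"
    using g h V_carrier by (auto simp: fixer_def inv_solve_right')
  also have "\<dots> \<longleftrightarrow> (\<forall>v\<in>V. g \<otimes> v \<otimes> inv g = h \<otimes> v \<otimes> inv h)"
  proof (intro iffI ballI)
    fix v assume *: "\<forall>v\<in>V. (g \<otimes> inv h) \<otimes> v \<otimes> inv (g \<otimes> inv h) = v" and v: "v \<in> V"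
    have "(g \<otimes> inv h) \<otimes> (h \<otimes> v \<otimes> inv h) \<otimes> inv (g \<otimes> inv h) = h \<otimes> v \<otimes> inv h"
      using * conj_in_V[OF h v] by blast
    then show "g \<otimes> v \<otimes> inv g = h \<otimes> v \<otimes> inv h"
      using g h V_carrier[OF v] by (simp add: inv_mult_group m_assoc cancel_left)
  next
    fix v assume *: "\<forall>v\<in>V. g \<otimes> v \<otimes> inv g = h \<otimes> v \<otimes> inv h" and v: "v \<in> V"
    have "g \<otimes> (inv h \<otimes> v \<otimes> h) \<otimes> inv g = h \<otimes> (inv h \<otimes> v \<otimes> h) \<otimes> inv h"
      using * conj_in_V[of "inv h" v] h v by simp
    then show "(g \<otimes> inv h) \<otimes> v \<otimes> inv (g \<otimes> inv h) = v"
      using g h V_carrier[OF v] by (simp add: inv_mult_group m_assoc cancel_left)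
  qed
  also have "\<dots> \<longleftrightarrow> g \<otimes> e1 \<otimes> inv g = h \<otimes> e1 \<otimes> inv h \<and> g \<otimes> e2 \<otimes> inv g = h \<otimes> e2 \<otimes> inv h"
  proof (intro iffI conjI ballI)
    fix v assume *: "g \<otimes> e1 \<otimes> inv g = h \<otimes> e1 \<otimes> inv h \<and> g \<otimes> e2 \<otimes> inv g = h \<otimes> e2 \<otimes> inv h" and "v \<in> V"
    then obtain i j where v: "v = E i j" using E_coords by blast
    have dvd: "int p dvd ca g - ca h" "int p dvd cc g - cc h" "int p dvd cb g - cb h" "int p dvd cd g - cd h"
      using * unfolding conj_e[OF g] conj_e[OF h] E_eq_iff by auto
    have "int p dvd (ca g * i + cb g * j) - (ca h * i + cb h * j)"
      by (rule dvd_combine2[OF dvd(1,3), of _ i j]) (simp add: algebra_simps)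
    moreover have "int p dvd (cc g * i + cd g * j) - (cc h * i + cd h * j)"
      by (rule dvd_combine2[OF dvd(2,4), of _ i j]) (simp add: algebra_simps)
    ultimately show "g \<otimes> v \<otimes> inv g = h \<otimes> v \<otimes> inv h"
      unfolding v conj_E[OF g] conj_E[OF h] E_eq_iff by blast
  qed (use e in auto)
  also have "\<dots> \<longleftrightarrow> int p dvd ca g - ca h \<and> int p dvd cb g - cb h \<and> int p dvd cc g - cc h \<and> int p dvd cd g - cd h"
    unfolding conj_e[OF g] conj_e[OF h] E_eq_iff by blast
  finally show ?thesis .
qed

lemma coeffs_one: "int p dvd ca \<one> - 1" "int p dvd cb \<one>" "int p dvd cc \<one>" "int p dvd cd \<one> - 1"
proof -
  have "E (ca \<one>) (cc \<one>) = E 1 0" "E (cb \<one>) (cd \<one>) = E 0 1"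
    using conj_e[of \<one>] by (simp_all add: E_def)
  then show "int p dvd ca \<one> - 1" "int p dvd cb \<one>" "int p dvd cc \<one>" "int p dvd cd \<one> - 1"
    unfolding E_eq_iff by simp_all
qed

lemma perfect_det:
  assumes perf: "perfect_group G" and g: "g \<in> carrier G"
  shows "int p dvd ca g * cd g - cb g * cc g - 1"
proof -
  have "[ca g * cd g - cb g * cc g = 1] (mod int p)"
  proof (rule perfect_group_mult_mod[OF perf _ _ g])
    fix g h assume gh: "g \<in> carrier G" "h \<in> carrier G"
    have "[ca (g \<otimes> h) = ca g * ca h + cb g * cc h] (mod int p)" "[cb (g \<otimes> h) = ca g * cb h + cb g * cd h] (mod int p)"
      "[cc (g \<otimes> h) = cc g * ca h + cd g * cc h] (mod int p)" "[cd (g \<otimes> h) = cc g * cb h + cd g * cd h] (mod int p)"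
      using coeffs_mult[OF gh] by (simp_all add: cong_iff_dvd_diff)
    then have "[ca (g \<otimes> h) * cd (g \<otimes> h) - cb (g \<otimes> h) * cc (g \<otimes> h) =
        (ca g * ca h + cb g * cc h) * (cc g * cb h + cd g * cd h) - (ca g * cb h + cb g * cd h) * (cc g * ca h + cd g * cc h)] (mod int p)"
      by (intro cong_diff cong_mult)
    also have "(ca g * ca h + cb g * cc h) * (cc g * cb h + cd g * cd h) - (ca g * cb h + cb g * cd h) * (cc g * ca h + cd g * cc h)
        = (ca g * cd g - cb g * cc g) * (ca h * cd h - cb h * cc h)" by (simp add: algebra_simps)
    finally show "[ca (g \<otimes> h) * cd (g \<otimes> h) - cb (g \<otimes> h) * cc (g \<otimes> h) =
        (ca g * cd g - cb g * cc g) * (ca h * cd h - cb h * cc h)] (mod int p)" .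
  next
    have "[ca \<one> * cd \<one> - cb \<one> * cc \<one> = 1 * 1 - 0 * 0] (mod int p)"
      by (intro cong_diff cong_mult) (use coeffs_one in \<open>simp_all add: cong_iff_dvd_diff\<close>)
    then show "[ca \<one> * cd \<one> - cb \<one> * cc \<one> = 1] (mod int p)" by simp
  qed
  then show ?thesis by (simp add: cong_iff_dvd_diff)
qed

lemma subgroup_fixer: "subgroup fixer G"
proof -
  have "fixer = (\<Inter>v\<in>V. elt_centralizer G v)"
    using e by (auto simp: fixer_def elt_centralizer_def)
  then show ?thesis
    using subgroups_Inter[of "elt_centralizer G ` V"] subgroup_elt_centralizer V_carrier e by fastforce
qed

lemma normal_fixer: "fixer \<lhd> G"
proof (rule normal_invI[OF subgroup_fixer])
  fix g h assume g: "g \<in> carrier G" and h: "h \<in> fixer"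
  have hG: "h \<in> carrier G" using h by (simp add: fixer_def)
  show "g \<otimes> h \<otimes> inv g \<in> fixer"
    unfolding fixer_def
  proof (intro CollectI conjI ballI)
    fix v assume v: "v \<in> V"
    define w where "w = inv g \<otimes> v \<otimes> g"
    have w: "w \<in> V" using conj_in_V[of "inv g" v] g v by (simp add: w_def)
    have vw: "v = g \<otimes> w \<otimes> inv g" using g V_carrier[OF v] by (simp add: w_def m_assoc cancel_left)
    show "g \<otimes> h \<otimes> inv g \<otimes> v = v \<otimes> (g \<otimes> h \<otimes> inv g)"
      unfolding vw using conj_commute_iff[OF g hG V_carrier[OF w]] h w by (simp add: fixer_def)
  qed (use g hG in simp)
qed

lemma V_subset_fixer: "V \<subseteq> fixer"
  using V_carrier comm by (auto simp: fixer_def)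

text \<open>The representation of the quotient reads off the matrix of a chosen representative of a coset.\<close>

theorem perfect_quotient_order:
  assumes perf: "perfect_group G" and fin: "finite (carrier G)" and p: "Factorial_Ring.prime p"
    and ndvd: "\<not> p dvd card (rcosets fixer)" and nontriv: "fixer \<noteq> carrier G"
  shows "120 dvd card (rcosets fixer) \<and> ([int p = 1] (mod 10) \<or> [int p = - 1] (mod 10))"
proof -
  let ?H = "G Mod fixer"
  interpret F: normal fixer G by (rule normal_fixer)
  have H: "group ?H" by (rule F.factorgroup_is_group)
  have carH: "carrier ?H = rcosets fixer" by (simp add: FactGroup_def)
  have orderH: "order ?H = card (rcosets fixer)" by (simp add: order_def carH)
  define rp where "rp A = (SOME g. g \<in> A)" for A :: "'a set"
  have rpA: "rp A \<in> carrier G \<and> fixer #> rp A = A" if "A \<in> carrier ?H" for A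
  proof -
    obtain g where g: "g \<in> carrier G" "A = fixer #> g" using \<open>A \<in> carrier ?H\<close> by (auto simp: carrier_FactGroup)
    have "rp A \<in> A" unfolding rp_def using rcos_self[OF g(1) subgroup_fixer] g(2) by (metis someI)
    then show ?thesis
      using repr_independence[OF _ g(1) subgroup_fixer, of "rp A"] g
        F.rcosets_carrier[OF is_group, of A] that carH by auto
  qed
  have diff: "g \<otimes> inv h \<in> fixer" if "g \<in> carrier G" "h \<in> carrier G" "fixer #> g = fixer #> h" for g h
    using rcos_self[OF that(1) subgroup_fixer] that F.rcos_module_imp[OF is_group that(2)] by metis
  have rep: "sl2_mod_prime_rep ?H p (ca \<circ> rp) (cb \<circ> rp) (cc \<circ> rp) (cd \<circ> rp)"
  proof (intro sl2_mod_prime_rep.intro H sl2_mod_prime_rep_axioms.intro)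
    fix A B assume A: "A \<in> carrier ?H" and B: "B \<in> carrier ?H"
    have AB: "A \<otimes>\<^bsub>?H\<^esub> B \<in> carrier ?H" by (rule monoid.m_closed[OF group.is_monoid[OF H] A B])
    let ?g = "rp (A \<otimes>\<^bsub>?H\<^esub> B)" and ?h = "rp A \<otimes> rp B"
    have "fixer #> ?h = A \<otimes>\<^bsub>?H\<^esub> B"
      using F.rcos_sum[of "rp A" "rp B"] rpA[OF A] rpA[OF B] by simp
    then have "?g \<otimes> inv ?h \<in> fixer" using diff rpA[OF A] rpA[OF B] rpA[OF AB] by simp
    then have s: "int p dvd ca ?g - ca ?h" "int p dvd cb ?g - cb ?h" "int p dvd cc ?g - cc ?h" "int p dvd cd ?g - cd ?h"
      using same_coeffs_iff[of ?g ?h] rpA[OF A] rpA[OF B] rpA[OF AB] by auto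
    have m: "int p dvd ca ?h - (ca (rp A) * ca (rp B) + cb (rp A) * cc (rp B))"
      "int p dvd cb ?h - (ca (rp A) * cb (rp B) + cb (rp A) * cd (rp B))"
      "int p dvd cc ?h - (cc (rp A) * ca (rp B) + cd (rp A) * cc (rp B))"
      "int p dvd cd ?h - (cc (rp A) * cb (rp B) + cd (rp A) * cd (rp B))"
      using coeffs_mult rpA[OF A] rpA[OF B] by auto
    show "int p dvd (ca \<circ> rp) (A \<otimes>\<^bsub>?H\<^esub> B) - ((ca \<circ> rp) A * (ca \<circ> rp) B + (cb \<circ> rp) A * (cc \<circ> rp) B) \<and>
      int p dvd (cb \<circ> rp) (A \<otimes>\<^bsub>?H\<^esub> B) - ((ca \<circ> rp) A * (cb \<circ> rp) B + (cb \<circ> rp) A * (cd \<circ> rp) B) \<and>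
      int p dvd (cc \<circ> rp) (A \<otimes>\<^bsub>?H\<^esub> B) - ((cc \<circ> rp) A * (ca \<circ> rp) B + (cd \<circ> rp) A * (cc \<circ> rp) B) \<and>
      int p dvd (cd \<circ> rp) (A \<otimes>\<^bsub>?H\<^esub> B) - ((cc \<circ> rp) A * (cb \<circ> rp) B + (cd \<circ> rp) A * (cd \<circ> rp) B)"
      unfolding comp_def
      by (intro conjI dvd_combine2[OF s(1) m(1), of _ 1 1] dvd_combine2[OF s(2) m(2), of _ 1 1]
          dvd_combine2[OF s(3) m(3), of _ 1 1] dvd_combine2[OF s(4) m(4), of _ 1 1]) simp_all
  next
    have 1: "\<one>\<^bsub>?H\<^esub> \<in> carrier ?H" by (rule monoid.one_closed[OF group.is_monoid[OF H]])
    let ?g = "rp \<one>\<^bsub>?H\<^esub>"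
    have "?g \<otimes> inv \<one> \<in> fixer" using diff[of ?g \<one>] rpA[OF 1] F.subset by simp
    then have s: "int p dvd ca ?g - ca \<one>" "int p dvd cb ?g - cb \<one>" "int p dvd cc ?g - cc \<one>" "int p dvd cd ?g - cd \<one>"
      using same_coeffs_iff[of ?g \<one>] rpA[OF 1] by auto
    show "int p dvd (ca \<circ> rp) \<one>\<^bsub>?H\<^esub> - 1" "int p dvd (cb \<circ> rp) \<one>\<^bsub>?H\<^esub>"
      "int p dvd (cc \<circ> rp) \<one>\<^bsub>?H\<^esub>" "int p dvd (cd \<circ> rp) \<one>\<^bsub>?H\<^esub> - 1"
      using dvd_add[OF s(1) coeffs_one(1)] dvd_add[OF s(2) coeffs_one(2)]
        dvd_add[OF s(3) coeffs_one(3)] dvd_add[OF s(4) coeffs_one(4)] by simp_all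
  next
    fix A assume "A \<in> carrier ?H"
    then show "int p dvd (ca \<circ> rp) A * (cd \<circ> rp) A - (cb \<circ> rp) A * (cc \<circ> rp) A - 1"
      using perfect_det[OF perf] rpA by simp
  next
    fix A B assume A: "A \<in> carrier ?H" and B: "B \<in> carrier ?H"
      and "int p dvd (ca \<circ> rp) A - (ca \<circ> rp) B" "int p dvd (cb \<circ> rp) A - (cb \<circ> rp) B"
        "int p dvd (cc \<circ> rp) A - (cc \<circ> rp) B" "int p dvd (cd \<circ> rp) A - (cd \<circ> rp) B"
    then have "rp A \<otimes> inv rp B \<in> fixer" using same_coeffs_iff rpA by simp
    then have "rp A \<in> fixer #> rp B"
      using F.rcos_module_rev[OF is_group] rpA[OF A] rpA[OF B] by blast
    then have "fixer #> rp B = fixer #> rp A"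
      using repr_independence[OF _ _ subgroup_fixer] rpA[OF B] by blast
    then show "A = B" using rpA[OF A] rpA[OF B] by simp
  next
    show "finite (carrier ?H)" using fin rcosets_finite F.subset carH
      by (metis finite_Pow_iff finite_subset rcosets_subset_PowG subgroup_fixer)
  qed (use p ndvd orderH in simp_all)
  interpret R: sl2_mod_prime_rep ?H p "ca \<circ> rp" "cb \<circ> rp" "cc \<circ> rp" "cd \<circ> rp" by (rule rep)
  have "perfect_group ?H"
    by (rule perfect_group_surj_hom[OF perf H F.r_coset_hom_Mod]) (simp add: carrier_FactGroup)
  moreover have "carrier ?H \<noteq> {\<one>\<^bsub>?H\<^esub>}"
  proof
    assume triv: "carrier ?H = {\<one>\<^bsub>?H\<^esub>}"
    have "g \<in> fixer" if g: "g \<in> carrier G" for g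
    proof -
      have "fixer #> g \<in> carrier ?H" using g by (auto simp: carrier_FactGroup)
      then have "fixer #> g = fixer" using triv by simp
      then show ?thesis using rcos_self[OF g subgroup_fixer] by simp
    qed
    with nontriv F.subset show False by blast
  qed
  ultimately show ?thesis using R.perfect_order orderH by simp
qed

end

section \<open>Elements of order p in perfect POEC groups\<close>

text \<open>Any nontrivial \<open>e1\<close> and any \<open>e2\<close> outside the powers of \<open>e1\<close> will do: independence gives
\<open>p ^ 2\<close> distinct products of powers, which exhaust \<open>V\<close>.\<close>

lemma (in group) elementary_abelian_basis:
  assumes V: "subgroup V G" and p: "Factorial_Ring.prime p" and card: "card V = p ^ 2"
    and comm: "\<And>v w. v \<in> V \<Longrightarrow> w \<in> V \<Longrightarrow> v \<otimes> w = w \<otimes> v"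
    and exponent: "\<And>v. v \<in> V \<Longrightarrow> v [^] p = \<one>"
  obtains e1 e2 where "e1 \<in> V" "e2 \<in> V"
    "\<And>v. v \<in> V \<Longrightarrow> \<exists>(i::int) (j::int). v = e1 [^] i \<otimes> e2 [^] j"
    "\<And>(i::int) (j::int). e1 [^] i \<otimes> e2 [^] j = \<one> \<longleftrightarrow> int p dvd i \<and> int p dvd j"
proof -
  have p1: "1 < p" by (rule prime_gt_1_nat[OF p])
  have VG: "v \<in> carrier G" if "v \<in> V" for v using subgroup.mem_carrier[OF V that] .
  have finV: "finite V" using card p1 by (metis card.infinite power_eq_0_iff not_less_zero)
  have ord: "ord v = p" if "v \<in> V" "v \<noteq> \<one>" for v
  proof -
    have "ord v dvd p" using exponent[OF that(1)] pow_eq_id[OF VG[OF that(1)]] by simp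
    moreover have "ord v \<noteq> 1" using ord_eq_1[OF VG[OF that(1)]] that(2) by simp
    ultimately show ?thesis using p unfolding prime_nat_iff by blast
  qed
  have powV: "v [^] (i::int) \<in> V" if "v \<in> V" for v i by (rule subgroup_int_pow_closed[OF V that])
  have "p ^ 2 \<noteq> 1" using p1 by simp
  then have "card V \<noteq> card {\<one>}" unfolding card by simp
  then have "V \<noteq> {\<one>}" by blast
  then obtain e1 where e1: "e1 \<in> V" "e1 \<noteq> \<one>" using subgroup.one_closed[OF V] by blast
  have gen: "generate G {e1} = range (\<lambda>k::int. e1 [^] k)"
    using generate_pow[OF VG[OF e1(1)]] by auto
  have "card (generate G {e1}) = p" using generate_pow_card[OF VG[OF e1(1)]] ord[OF e1] by simp
  then have "card (range (\<lambda>k::int. e1 [^] k)) < card V" using gen card p1 by (simp add: power2_eq_square)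
  then have "\<not> V \<subseteq> range (\<lambda>k::int. e1 [^] k)"
    using card_mono[of "range (\<lambda>k::int. e1 [^] k)" V] powV[OF e1(1)] finV finite_subset[of "range (\<lambda>k::int. e1 [^] k)" V]
    by (meson image_subsetI not_le)
  then obtain e2 where e2: "e2 \<in> V" "e2 \<notin> range (\<lambda>k::int. e1 [^] k)" by blast
  have "e1 [^] (0::int) = \<one>" by simp
  with e2(2) have e2': "e2 \<noteq> \<one>" by (metis rangeI)
  note c = VG[OF e1(1)] VG[OF e2(1)]
  have indep: "e1 [^] i \<otimes> e2 [^] j = \<one> \<longleftrightarrow> int p dvd i \<and> int p dvd j" for i j :: int
  proof
    assume "int p dvd i \<and> int p dvd j"
    then have "e1 [^] i = \<one>" "e2 [^] j = \<one>"
      using int_pow_eq_id[OF c(1)] int_pow_eq_id[OF c(2)] ord[OF e1] ord[OF e2(1) e2'] by auto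
    then show "e1 [^] i \<otimes> e2 [^] j = \<one>" by simp
  next
    assume *: "e1 [^] i \<otimes> e2 [^] j = \<one>"
    have e2j: "e2 [^] j = e1 [^] (- i)"
      using * c by (metis int_pow_closed int_pow_neg inv_equality inv_inv)
    have j: "int p dvd j"
    proof (rule ccontr)
      assume "\<not> int p dvd j"
      then have "coprime j (int p)" using p by (metis coprime_commute prime_imp_coprime prime_int_nat_transfer prime_nat_int_transfer)
      then obtain r where "[j * r = 1] (mod int p)" using cong_solve_coprime_int by blast
      then have "e2 [^] (j * r) = e2 [^] (1::int)"
        using int_pow_eq[OF c(2), of "j * r" 1] ord[OF e2(1) e2'] by (simp add: cong_iff_dvd_diff dvd_diff_commute)
      then have "e2 = (e2 [^] j) [^] r" using c by (simp add: int_pow_pow)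
      also have "\<dots> = e1 [^] (- i * r)" unfolding e2j using c by (simp add: int_pow_pow)
      finally show False using e2(2) by blast
    qed
    then have "e2 [^] j = \<one>" using int_pow_eq_id[OF c(2)] ord[OF e2(1) e2'] by simp
    with * have "e1 [^] i = \<one>" using c by simp
    with j show "int p dvd i \<and> int p dvd j" using int_pow_eq_id[OF c(1)] ord[OF e1] by simp
  qed
  let ?I = "{0..<int p}" and ?E = "\<lambda>(i::int, j::int). e1 [^] i \<otimes> e2 [^] j"
  have "inj_on ?E (?I \<times> ?I)"
  proof (rule inj_onI, clarify)
    fix i j k l :: int assume I: "i \<in> ?I" "j \<in> ?I" "k \<in> ?I" "l \<in> ?I"
      and eq: "e1 [^] i \<otimes> e2 [^] j = e1 [^] k \<otimes> e2 [^] l"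
    have cm: "e1 [^] (- k) \<otimes> e2 [^] (- l) = e2 [^] (- l) \<otimes> e1 [^] (- k)"
      using comm powV e1 e2 by blast
    have "e1 [^] (i - k) \<otimes> e2 [^] (j - l) = e1 [^] (- k) \<otimes> (e1 [^] i \<otimes> e2 [^] j) \<otimes> e2 [^] (- l)"
    proof -
      have "e1 [^] (i - k) = e1 [^] (- k) \<otimes> e1 [^] i" "e2 [^] (j - l) = e2 [^] j \<otimes> e2 [^] (- l)"
        using c by (simp_all flip: int_pow_mult)
      then show ?thesis using c by (simp add: m_assoc)
    qed
    also have "\<dots> = e1 [^] (- k) \<otimes> (e1 [^] k \<otimes> e2 [^] l) \<otimes> e2 [^] (- l)" unfolding eq ..
    also have "\<dots> = \<one>" using c by (simp add: m_assoc int_pow_neg cancel_left)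
    finally have "int p dvd i - k" "int p dvd j - l" using indep by auto
    with I show "i = k \<and> j = l" using zdvd_imp_le[of "int p"] by (metis mod_eq_dvd_iff mod_pos_pos_trivial atLeastLessThan_iff)
  qed
  then have "card (?E ` (?I \<times> ?I)) = card V" using card by (simp add: card_image power2_eq_square)
  moreover have "?E ` (?I \<times> ?I) \<subseteq> V" using powV e1 e2 subgroup.m_closed[OF V] by auto
  ultimately have img: "?E ` (?I \<times> ?I) = V" using finV by (simp add: card_subset_eq)
  have span: "\<exists>(i::int) (j::int). v = e1 [^] i \<otimes> e2 [^] j" if "v \<in> V" for v
    using that img by auto
  show thesis by (rule that[OF e1(1) e2(1) span indep])
qed

text \<open>All nontrivial elements of \<open>V\<close> have order \<open>p\<close>, so the POEC property lets them commute with each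
other and with every element of prime order; commutativity is what makes \<open>V\<close> closed under products.\<close>

lemma POEC_group_prime_torsion:
  fixes G (structure) and p :: nat
  assumes poec: "POEC_group G" and p: "Factorial_Ring.prime p"
  defines "V \<equiv> {x \<in> carrier G. x [^] p = \<one>}"
  shows "V \<lhd> G" and "\<And>v w. v \<in> V \<Longrightarrow> w \<in> V \<Longrightarrow> v \<otimes> w = w \<otimes> v"
    and "\<And>v t. v \<in> V \<Longrightarrow> t \<in> carrier G \<Longrightarrow> Factorial_Ring.prime (group.ord G t) \<Longrightarrow> t \<otimes> v = v \<otimes> t"
proof -
  interpret group G using poec by (simp add: POEC_group_def)
  have VG: "v \<in> carrier G" if "v \<in> V" for v using that by (simp add: V_def)
  have ord: "ord v = p" if "v \<in> V" "v \<noteq> \<one>" for v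
  proof -
    have "ord v dvd p" using that pow_eq_id[of v p] by (simp add: V_def)
    moreover have "ord v \<noteq> 1" using ord_eq_1 that by (simp add: V_def)
    ultimately show ?thesis using p unfolding prime_nat_iff by blast
  qed
  show torsion: "t \<otimes> v = v \<otimes> t" if "v \<in> V" "t \<in> carrier G" "Factorial_Ring.prime (ord t)" for v t
  proof (cases "v = \<one>")
    case False
    then have "Factorial_Ring.prime (ord v)" using ord that(1) p by simp
    with poec that VG show ?thesis by (simp add: POEC_group_def)
  qed (use that in simp)
  show comm: "v \<otimes> w = w \<otimes> v" if "v \<in> V" "w \<in> V" for v w
  proof (cases "v = \<one>")
    case False
    then show ?thesis using torsion[of w v] ord that p VG by simp
  qed (use that VG in simp)
  have sub: "subgroup V G"
  proof (rule subgroupI)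
    fix v w assume "v \<in> V" "w \<in> V"
    then show "v \<otimes> w \<in> V" using comm[of v w] by (simp add: V_def pow_mult_distrib)
  qed (auto simp: V_def nat_pow_inv)
  show "V \<lhd> G"
  proof (rule normal_invI[OF sub])
    fix g v assume g: "g \<in> carrier G" and v: "v \<in> V"
    have "(g \<otimes> v \<otimes> inv g) [^] n = g \<otimes> v [^] n \<otimes> inv g" for n :: nat
      using g VG[OF v] by (induction n) (simp_all add: m_assoc cancel_left)
    then show "g \<otimes> v \<otimes> inv g \<in> V" using g v by (simp add: V_def)
  qed
qed

text \<open>By Cauchy's theorem a prime divisor of the order is the order of an element, hence equal to \<open>p\<close>.\<close>

lemma (in group) prime_torsion_subgroup_card:
  assumes V: "subgroup V G" and fin: "finite V" and p: "Factorial_Ring.prime p"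
    and exponent: "\<And>v. v \<in> V \<Longrightarrow> v [^] p = \<one>"
  shows "\<exists>k. card V = p ^ k"
proof -
  have pos: "card V \<noteq> 0" using fin subgroup.one_closed[OF V] by auto
  obtain m where m: "card V = p ^ multiplicity p (card V) * m" "\<not> p dvd m"
    using multiplicity_decompose'[of "card V" p] pos p not_prime_unit by metis
  have "m = 1"
  proof (rule ccontr)
    assume "m \<noteq> 1"
    then obtain r where r: "Factorial_Ring.prime r" "r dvd m" using prime_factor_nat by blast
    then have "r dvd card V" using m(1) by (metis dvd_mult)
    then obtain x where x: "x \<in> V" "x \<noteq> \<one>" "x [^] r = \<one>"
      using exists_prime_order_in_subgroup[OF V fin r(1)] by blast
    have xG: "x \<in> carrier G" using subgroup.mem_carrier[OF V x(1)] .
    have "ord x dvd r" "ord x dvd p" using pow_eq_id[OF xG] x(3) exponent[OF x(1)] by auto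
    moreover have "ord x \<noteq> 1" using ord_eq_1[OF xG] x(2) by simp
    ultimately have "r = p" using r(1) p unfolding prime_nat_iff by metis
    with r(2) m(2) show False by simp
  qed
  with m(1) show ?thesis by (metis mult_1_right)
qed

text \<open>An element g maps v to a power of v, and the exponent is multiplicative in g modulo p; on a perfect
group it is therefore 1.\<close>

lemma perfect_group_normal_prime_order_central:
  fixes G (structure) and p :: nat
  assumes perf: "perfect_group G" and p: "Factorial_Ring.prime p" and V: "V \<lhd> G" "card V = p"
    and v: "v \<in> V"
  shows "v \<in> group_center G"
proof -
  interpret group G using perf by (simp add: perfect_group_def)
  have sub: "subgroup V G" using V(1) by (rule normal_imp_subgroup)
  have vG: "v \<in> carrier G" using subgroup.mem_carrier[OF sub v] .
  show ?thesis
  proof (cases "v = \<one>")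
    case True then show ?thesis by (simp add: group_center_def)
  next
    case False
    have finV: "finite V" using V(2) prime_gt_0_nat[OF p] card_ge_0_finite by metis
    have genV: "generate G {v} \<subseteq> V" using generate_subgroup_incl[OF _ sub, of "{v}"] v by simp
    have "card (generate G {v}) dvd card V"
      by (rule card_subgroup_dvd[OF generate_is_subgroup sub genV]) (use vG in simp)
    then have "ord v dvd p" using generate_pow_card[OF vG] V(2) by simp
    moreover have "ord v \<noteq> 1" using ord_eq_1[OF vG] False by simp
    ultimately have ord: "ord v = p" using p unfolding prime_nat_iff by blast
    then have "generate G {v} = V" using card_subset_eq[OF finV genV] generate_pow_card[OF vG] V(2) by simp
    then have Vpow: "\<exists>k::int. w = v [^] k" if "w \<in> V" for w
      using that generate_pow[OF vG] by auto
    define f where "f g = (SOME k::int. g \<otimes> v \<otimes> inv g = v [^] k)" for g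
    have f: "g \<otimes> v \<otimes> inv g = v [^] f g" if "g \<in> carrier G" for g
      unfolding f_def by (rule someI_ex) (use Vpow V(1) that v normal_inv_iff in blast)
    have eq: "v [^] i = v [^] j \<longleftrightarrow> [i = j] (mod int p)" for i j :: int
      using int_pow_eq[OF vG, of i j] ord by (simp add: cong_iff_dvd_diff dvd_diff_commute)
    have f1: "[f g = 1] (mod int p)" if "g \<in> carrier G" for g
    proof (rule perfect_group_mult_mod[OF perf _ _ that])
      fix g h assume g: "g \<in> carrier G" and h: "h \<in> carrier G"
      have hom: "group_hom G G (\<lambda>x. g \<otimes> x \<otimes> inv g)"
        using g by unfold_locales (auto simp: hom_def m_assoc cancel_left)
      have "v [^] f (g \<otimes> h) = g \<otimes> (h \<otimes> v \<otimes> inv h) \<otimes> inv g"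
        using f[of "g \<otimes> h"] g h vG by (simp add: inv_mult_group m_assoc)
      also have "\<dots> = (g \<otimes> v \<otimes> inv g) [^] f h"
        unfolding f[OF h] using group_hom.hom_int_pow[OF hom vG] by simp
      also have "\<dots> = v [^] (f g * f h)" unfolding f[OF g] using vG by (simp add: int_pow_pow)
      finally show "[f (g \<otimes> h) = f g * f h] (mod int p)" unfolding eq .
    next
      have "v [^] f \<one> = v [^] (1::int)" using f[of \<one>] vG by simp
      then show "[f \<one> = 1] (mod int p)" unfolding eq .
    qed
    have "v \<otimes> g = g \<otimes> v" if g: "g \<in> carrier G" for g
    proof -
      have "g \<otimes> v \<otimes> inv g = v" using f[OF g] eq[of "f g" 1] f1[OF g] vG by simp
      then show ?thesis using g vG by (metis inv_solve_right' m_closed)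
    qed
    then show ?thesis using vG by (simp add: group_center_def)
  qed
qed

theorem theorem2p20:
  fixes G :: "('a, 'b) monoid_scheme" and p :: nat
  assumes "group G"
    and "finite (carrier G)"
    and "perfect_group G"
    and "POEC_group G"
    and "Factorial_Ring.prime p"
    and "p dvd order G"
    and "\<not> (2 ^ 4 dvd order G) \<or> \<not> (3 dvd order G) \<or> \<not> (5 dvd order G)
      \<or> (\<not> [int p = 1] (mod 10) \<and> \<not> [int p = - 1] (mod 10))"
  shows "p ^ 3 dvd order G"
proof (rule ccontr)
  assume n3: "\<not> p ^ 3 dvd order G"
  interpret group G by fact
  note fin = assms(2) and perf = assms(3) and poec = assms(4) and p = assms(5)
  define V where "V = {x \<in> carrier G. x [^]\<^bsub>G\<^esub> p = \<one>\<^bsub>G\<^esub>}"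
  note T = POEC_group_prime_torsion[OF poec p, folded V_def]
  have V: "subgroup V G" by (rule normal_imp_subgroup[OF T(1)])
  have exponent: "v [^]\<^bsub>G\<^esub> p = \<one>\<^bsub>G\<^esub>" if "v \<in> V" for v using that by (simp add: V_def)
  have finV: "finite V" using fin by (simp add: V_def)
  obtain x where x: "x \<in> carrier G" "x \<in> V" "x \<notin> group_center G"
    using perfect_group_prime_cube_dvd_if_central[OF perf fin p assms(6)] n3 by (auto simp: V_def)
  obtain k where k: "card V = p ^ k" using prime_torsion_subgroup_card[OF V finV p exponent] by blast
  have Vdvd: "card V dvd order G" using lagrange[OF V] by (metis dvd_triv_right)
  have "k < 3"
  proof (rule ccontr)
    assume "\<not> k < 3"
    then have "p ^ 3 dvd p ^ k" by (intro le_imp_power_dvd) simp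
    with Vdvd k n3 show False by (metis dvd_trans)
  qed
  moreover have "k \<noteq> 0"
  proof
    assume "k = 0"
    then have "V = {x}" using k x(2) by (auto simp: card_1_singleton_iff)
    then have "x = \<one>\<^bsub>G\<^esub>" using subgroup.one_closed[OF V] by simp
    with x(3) show False by (simp add: group_center_def)
  qed
  moreover have "k \<noteq> 1"
    using perfect_group_normal_prime_order_central[OF perf p T(1) _ x(2)] k x(3) by auto
  ultimately have "k = 2" by linarith
  with k have card: "card V = p ^ 2" by simp
  obtain e1 e2 where e: "e1 \<in> V" "e2 \<in> V"
    "\<And>v. v \<in> V \<Longrightarrow> \<exists>(i::int) (j::int). v = e1 [^]\<^bsub>G\<^esub> i \<otimes>\<^bsub>G\<^esub> e2 [^]\<^bsub>G\<^esub> j"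
    "\<And>(i::int) (j::int). e1 [^]\<^bsub>G\<^esub> i \<otimes>\<^bsub>G\<^esub> e2 [^]\<^bsub>G\<^esub> j = \<one>\<^bsub>G\<^esub> \<longleftrightarrow> int p dvd i \<and> int p dvd j"
    using elementary_abelian_basis[OF V p card T(2) exponent] by blast
  interpret P: normal_plane G p V e1 e2
    by (intro normal_plane.intro is_group normal_plane_axioms.intro T(1,2) e)
  let ?C = P.fixer
  have C: "subgroup ?C G" by (rule P.subgroup_fixer)
  have order: "card (rcosets\<^bsub>G\<^esub> ?C) * card ?C = order G" by (rule lagrange[OF C])
  have p2: "p ^ 2 dvd card ?C" using card_subgroup_dvd[OF V C P.V_subset_fixer] card by simp
  have "\<not> p dvd card (rcosets\<^bsub>G\<^esub> ?C)"
  proof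
    assume "p dvd card (rcosets\<^bsub>G\<^esub> ?C)"
    then have "p * p ^ 2 dvd order G" unfolding order[symmetric] using p2 by (rule mult_dvd_mono)
    with n3 show False by (simp add: power_numeral_reduce)
  qed
  moreover have "?C \<noteq> carrier G"
  proof
    assume "?C = carrier G"
    have "x \<otimes>\<^bsub>G\<^esub> g = g \<otimes>\<^bsub>G\<^esub> x" if "g \<in> carrier G" for g
    proof -
      have "g \<in> ?C" using that \<open>?C = carrier G\<close> by simp
      then show ?thesis using x(2) by (simp add: P.fixer_def)
    qed
    with x show False by (simp add: group_center_def)
  qed
  ultimately have quot: "120 dvd card (rcosets\<^bsub>G\<^esub> ?C)" "[int p = 1] (mod 10) \<or> [int p = - 1] (mod 10)"
    using P.perfect_quotient_order[OF perf fin p] by auto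
  \<comment> \<open>The POEC property puts an involution into the centralizer of V, which contributes the fourth
    factor 2.\<close>
  have "2 dvd order G" using quot(1) order by (metis dvd_mult2 dvd_trans[of 2 120] even_numeral)
  then obtain t where t: "t \<in> carrier G" "ord t = 2" using cauchy[OF fin two_is_prime_nat] by blast
  have "t \<in> ?C" using T(3)[OF _ t(1)] t by (simp add: P.fixer_def)
  then have "card (generate G {t}) dvd card ?C"
    by (intro card_subgroup_dvd[OF generate_is_subgroup C] generate_subgroup_incl[OF _ C]) (use t in auto)
  then have "2 dvd card ?C" using generate_pow_card[OF t(1)] t(2) by simp
  then have "120 * 2 dvd order G" unfolding order[symmetric] using quot(1) by (intro mult_dvd_mono)
  then have 240: "240 dvd order G" by simp
  have "2 ^ 4 dvd (240::nat)" "3 dvd (240::nat)" "5 dvd (240::nat)" by simp_all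
  then have "2 ^ 4 dvd order G" "3 dvd order G" "5 dvd order G" using 240 by (blast intro: dvd_trans)+
  with assms(7) quot(2) show False by blast
qed

end
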